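(* For every pair of integers $t,d\geq 1$ and every integer $k\geq (t+4)^{d}-(t+3)^{d}+(t+2)^{d}-2^{d}+d(t+2)+3$, there exists a measurable $k$-coloring $c:\mathbb{R}^d\to\{1,\dots,k\}$ such that no cube in $\mathbb{R}^d$ has a fair splitting of size at most $t$.
   Context: A $k$-coloring $c:\mathbb{R}^d\to\{1,\dots,k\}$ is measurable if each color class $c^{-1}(i)$ is Lebesgue measurable. A cube in $\mathbb{R}^d$ is a Cartesian product $[a_1,b_1]\times\cdots\times[a_d,b_d]$ of $d$ non-degenerate intervals of the same length. A splitting of a cube is given by a finite family of axis-aligned hyperplanes (hyperplanes of the form $\{x: x_i = s\}$ with $a_i<s<b_i$); these hyperplanes cut the cube into a family of cuboids (axis-parallel boxes). The size of the splitting is the maximum, over the $d$ coordinate directions $i$, of the number of hyperplanes of the family orthogonal to the $i$-th axis. A splitting of a cube $Q$ is fair (for the coloring $c$) if the resulting family of cuboids can be partitioned into two subfamilies $F_1,F_2$ such that for every color $j$, the union of the cuboids in $F_1$ and the union of the cuboids in $F_2$ each contain exactly half of the $d$-dimensional Lebesgue measure of $c^{-1}(j)\cap Q$. *)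

theory Defs
  imports "HOL-Analysis.Analysis"
begin

definition cube_of :: "real^'n \<Rightarrow> real \<Rightarrow> (real^'n) set" where
  "cube_of a r = {x. \<forall>i. a$i \<le> x$i \<and> x$i \<le> a$i + r}"

definition split_cells :: "real \<Rightarrow> real \<Rightarrow> real set \<Rightarrow> real set set" where
  "split_cells lo hi H =
     {{u..v} | u v. u \<in> insert lo (insert hi H) \<and> v \<in> insert lo (insert hi H) \<and> u < v
                   \<and> (\<forall>s\<in>H. \<not> (u < s \<and> s < v))}"

text \<open>Cuboids of the splitting of cube_of a r by the hyperplanes {x. x$i = s}, s \<in> H i.\<close>
definition split_cuboids :: "real^'n \<Rightarrow> real \<Rightarrow> ('n \<Rightarrow> real set) \<Rightarrow> (real^'n) set set" where
  "split_cuboids a r H =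
     {{x. \<forall>i. x$i \<in> I i} | I. \<forall>i. I i \<in> split_cells (a$i) (a$i + r) (H i)}"

definition fair_splitting ::
  "(real^'n \<Rightarrow> nat) \<Rightarrow> nat \<Rightarrow> real^'n \<Rightarrow> real \<Rightarrow> ('n \<Rightarrow> real set) \<Rightarrow> bool" where
  "fair_splitting c k a r H \<longleftrightarrow>
     (\<forall>i. finite (H i) \<and> H i \<subseteq> {a$i<..<a$i + r}) \<and>
     (\<exists>F1. F1 \<subseteq> split_cuboids a r H \<and>
        (\<forall>j\<in>{1..k}.
           measure lebesgue (c -` {j} \<inter> \<Union>F1) = measure lebesgue (c -` {j} \<inter> cube_of a r) / 2 \<and>
           measure lebesgue (c -` {j} \<inter> \<Union>(split_cuboids a r H - F1))
             = measure lebesgue (c -` {j} \<inter> cube_of a r) / 2))"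

end

theory Submission
  imports Defs
begin

text \<open>
  A cube with a splitting of size at most \<open>t\<close> is described by \<open>d(t+2)\<close> real numbers and finitely many
  combinatorial data, whereas fairness imposes one equation per colour. Hence \<open>d(t+2) + 2\<close> colours
  suffice for a dimension count: for cubes inside a bounded window whose side is bounded below, some
  cell of the splitting contains a whole cell of a fixed fine grid, and recolouring a small part of
  each grid cell in \<open>q\<close> possible proportions per colour yields, by counting for large \<open>q\<close>, a colouring
  close to the given one for which all these splittings are unfair by a uniform margin. Doing
  this successively for larger windows and smaller sides, with changes small compared with all earlier
  margins, produces a colouring that works in the limit.
\<close>

section \<open>Measurable sets of prescribed measure and counting\<close>

text \<open>The obstacle is that the splittings form a continuum, so a property that holds
  generically for each of them need not hold for all at once. The number \<open>q\<close> therefore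
  plays two roles. Parameters are rounded to multiples of \<open>1/q\<close>, which leaves about
  \<open>q^D\<close> cases with \<open>D = d(t+2)\<close> (two end points and \<open>t\<close> cuts
  in each direction); and each colour of each grid cell has \<open>q\<close> possible amounts, so
  that near balance in one colour has probability at most of order \<open>1/q\<close>. The last
  colour absorbs what the others leave, hence only \<open>k - 1\<close> colours can be adjusted
  freely, and \<open>q^D * q^-(k-1)\<close> tends to zero once \<open>k >= D + 2\<close>. Rounding
  error and balance threshold are both of order \<open>1/q\<close>, so avoiding the finitely many
  rounded cases by twice the error leaves a positive margin on the whole continuum. Uniformity of
  this margin is what lets it survive all later recolourings.\<close>

lemma slab_measure_le:
  fixes i :: "'n::finite" and R :: real
  assumes "R \<ge> 0" "u \<le> v"
  shows "measure lebesgue (cbox (\<chi> i. -R) (\<chi> i. R) \<inter> {x::real^'n. u \<le> x$i \<and> x$i \<le> v})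
           \<le> (2 * R) ^ (CARD('n) - 1) * (v - u)"
proof -
  let ?a = "\<chi> l. if l = i then u else -R" and ?b = "\<chi> l. if l = i then v else R"
  have ne: "cbox ?a ?b \<noteq> {}" using assms by (simp add: interval_ne_empty_cart)
  have "measure lebesgue (cbox (\<chi> i. -R) (\<chi> i. R) \<inter> {x::real^'n. u \<le> x$i \<and> x$i \<le> v})
        \<le> measure lebesgue (cbox ?a ?b)"
  proof (rule measure_mono_fmeasurable)
    have "{x::real^'n. u \<le> x$i \<and> x$i \<le> v} = {x. x$i \<ge> u} \<inter> {x. x$i \<le> v}" by auto
    then have "closed {x::real^'n. u \<le> x$i \<and> x$i \<le> v}"
      by (simp add: closed_Int closed_halfspace_component_le_cart closed_halfspace_component_ge_cart)
    then show "cbox (\<chi> i. -R) (\<chi> i. R) \<inter> {x::real^'n. u \<le> x$i \<and> x$i \<le> v} \<in> sets lebesgue"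
      by (simp add: borel_closed closed_Int)
  qed (auto simp: mem_box_cart)
  also have "\<dots> = (\<Prod>l\<in>UNIV. ?b $ l - ?a $ l)" using content_cbox_cart[OF ne] by simp
  also have "\<dots> = (v - u) * (\<Prod>l\<in>UNIV - {i}. 2 * R)"
    by (subst prod.remove[of _ i]) (auto intro!: prod.cong)
  also have "\<dots> = (2 * R) ^ (CARD('n) - 1) * (v - u)"
    by (simp add: card_Diff_singleton)
  finally show ?thesis .
qed

text \<open>Cutting \<open>S\<close> by the half-space \<open>x$i \<le> \<tau>\<close> gives a
  measure that is Lipschitz in \<open>\<tau>\<close>, because the slab between two cuts, inside a
  box containing \<open>S\<close>, has measure proportional to its width. It runs from 0 to the full
  measure, so the intermediate value theorem applies.\<close>

lemma lmeasurable_subset_of_measure: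
  fixes S :: "(real^'n::finite) set"
  assumes S: "S \<in> lmeasurable" "bounded S" and m: "0 \<le> m" "m \<le> measure lebesgue S"
  obtains T where "T \<subseteq> S" "T \<in> lmeasurable" "measure lebesgue T = m"
proof -
  obtain i :: 'n where True by blast
  obtain R where R: "R > 0" "\<And>x. x \<in> S \<Longrightarrow> norm x \<le> R"
    using S(2) bounded_pos by blast
  have comp: "\<bar>x$l\<bar> \<le> R" if "x \<in> S" for x l
    using R(2)[OF that] component_le_norm_cart[of x l] by linarith
  define g where "g = (\<lambda>\<tau>. measure lebesgue (S \<inter> {x. x$i \<le> \<tau>}))"
  have meas: "S \<inter> {x. x$i \<le> \<tau>} \<in> lmeasurable" for \<tau>
    by (rule fmeasurable_Int_fmeasurable[OF S(1)])
       (simp add: borel_closed closed_halfspace_component_le_cart)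
  let ?K = "(2 * R) ^ (CARD('n) - 1)"
  have lip: "\<bar>g v - g u\<bar> \<le> ?K * \<bar>v - u\<bar>" if "u \<le> v" for u v
  proof -
    let ?D = "cbox (\<chi> i. -R) (\<chi> i. R) \<inter> {x::real^'n. u \<le> x$i \<and> x$i \<le> v}"
    have "{x::real^'n. u \<le> x$i \<and> x$i \<le> v} = {x. x$i \<ge> u} \<inter> {x. x$i \<le> v}" by auto
    then have D: "?D \<in> lmeasurable"
      by (intro lmeasurable_compact compact_Int_closed compact_cbox)
         (simp add: closed_Int closed_halfspace_component_le_cart closed_halfspace_component_ge_cart)
    have "g v \<le> measure lebesgue ((S \<inter> {x. x$i \<le> u}) \<union> ?D)"
      unfolding g_def
    proof (rule measure_mono_fmeasurable)
      show "S \<inter> {x. x$i \<le> v} \<subseteq> (S \<inter> {x. x$i \<le> u}) \<union> ?D"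
        using comp by (auto simp: mem_box_cart abs_le_iff) (smt (verit) comp)+
    qed (use meas D in \<open>auto intro: fmeasurable.Un\<close>)
    also have "\<dots> \<le> g u + measure lebesgue ?D"
      unfolding g_def using meas D by (intro measure_Un_le) auto
    finally have "g v \<le> g u + ?K * (v - u)"
      using slab_measure_le[of R u v i] R(1) that by linarith
    moreover have "g u \<le> g v"
      unfolding g_def using that by (intro measure_mono_fmeasurable meas) (auto intro: fmeasurableD meas)
    ultimately show ?thesis using that by simp
  qed
  have "\<bar>g v - g u\<bar> \<le> ?K * \<bar>v - u\<bar>" for u v
    using lip[of u v] lip[of v u] by (cases "u \<le> v") (auto simp: abs_minus_commute)
  then have "?K-lipschitz_on UNIV g"
    using R(1) by (intro lipschitz_onI) (auto simp: dist_real_def)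
  then have cont: "continuous_on UNIV g" by (rule lipschitz_on_continuous_on)
  have "S \<inter> {x. x$i \<le> -R-1} = {}"
  proof -
    have "\<not> x$i \<le> -R-1" if "x \<in> S" for x using comp[OF that, of i] by linarith
    then show ?thesis by blast
  qed
  then have "g (-R-1) \<le> m" using m by (simp add: g_def)
  moreover have "S \<inter> {x. x$i \<le> R} = S" using comp by (force simp: abs_le_iff)
  then have "m \<le> g R" using m by (simp add: g_def)
  ultimately obtain \<tau> where "g \<tau> = m"
    using IVT'[of g "-R-1" m R] continuous_on_subset[OF cont] R(1) by auto
  then show ?thesis using that[of "S \<inter> {x. x$i \<le> \<tau>}"] meas by (auto simp: g_def)
qed

lemma lmeasurable_equal_pieces:
  fixes S :: "(real^'n::finite) set"
  assumes "finite I" "S \<in> lmeasurable" "bounded S" "0 \<le> m" "real (card I) * m \<le> measure lebesgue S"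
  shows "\<exists>T. disjoint_family_on T I \<and>
           (\<forall>i\<in>I. T i \<subseteq> S \<and> T i \<in> lmeasurable \<and> measure lebesgue (T i) = m)"
  using assms
proof (induction I arbitrary: S rule: finite_induct)
  case empty
  then show ?case by (auto simp: disjoint_family_on_def)
next
  case (insert i I)
  have "m \<le> measure lebesgue S"
    using insert by (simp add: algebra_simps) (smt (verit) mult_nonneg_nonneg of_nat_0_le_iff)
  then obtain A where A: "A \<subseteq> S" "A \<in> lmeasurable" "measure lebesgue A = m"
    using lmeasurable_subset_of_measure insert by metis
  have "measure lebesgue (S - A) = measure lebesgue S - m"
    using A insert by (simp add: measurable_measure_Diff fmeasurableD)
  then have "real (card I) * m \<le> measure lebesgue (S - A)"
    using insert by (simp add: algebra_simps)
  then obtain T where T: "disjoint_family_on T I"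
     "\<forall>i\<in>I. T i \<subseteq> S - A \<and> T i \<in> lmeasurable \<and> measure lebesgue (T i) = m"
    using insert.IH[of "S - A"] insert.prems A by (auto intro: fmeasurable.Diff bounded_subset)
  have "disjoint_family_on (T(i := A)) (insert i I)"
    using T insert.hyps unfolding disjoint_family_on_def by (auto; blast)
  moreover have "\<forall>l\<in>insert i I. (T(i := A)) l \<subseteq> S \<and> (T(i := A)) l \<in> lmeasurable \<and>
      measure lebesgue ((T(i := A)) l) = m"
    using T A by auto
  ultimately show ?case by blast
qed

text \<open>Each \<open>f\<close> is recovered from its restriction to \<open>I - {z}\<close> and
  its value at \<open>z\<close>. Restricting the one coordinate \<open>z\<close> is how a single
  uncut grid cell saves a factor of order \<open>q\<close> in the count.\<close>

lemma card_PiE_le_by_fibers: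
  fixes X :: "'b set"
  assumes "finite I" "z \<in> I" "finite X"
    and fib: "\<And>f. f \<in> I \<rightarrow>\<^sub>E X \<Longrightarrow> card {x\<in>X. P (f(z := x))} \<le> B"
  shows "card {f \<in> I \<rightarrow>\<^sub>E X. P f} \<le> B * card X ^ (card I - 1)"
proof -
  let ?F = "(I - {z}) \<rightarrow>\<^sub>E X"
  have fin: "finite ?F" using assms by (intro finite_PiE) auto
  have sub: "{f \<in> I \<rightarrow>\<^sub>E X. P f} \<subseteq> (\<Union>g\<in>?F. (\<lambda>x. g(z := x)) ` {x\<in>X. P (g(z := x))})"
  proof
    fix f assume f: "f \<in> {f \<in> I \<rightarrow>\<^sub>E X. P f}"
    then have "f(z := undefined) \<in> ?F" by (auto simp: PiE_iff extensional_def)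
    moreover have "f = (f(z := undefined))(z := f z)" by simp
    ultimately show "f \<in> (\<Union>g\<in>?F. (\<lambda>x. g(z := x)) ` {x\<in>X. P (g(z := x))})"
      using f assms(2) by (intro UN_I[of "f(z := undefined)"] image_eqI[of _ _ "f z"]) auto
  qed
  have le: "card ((\<lambda>x. g(z := x)) ` {x\<in>X. P (g(z := x))}) \<le> B" if "g \<in> ?F" for g
  proof (cases "X = {}")
    case False
    then obtain y where "y \<in> X" by blast
    then have "g(z := y) \<in> I \<rightarrow>\<^sub>E X" using that assms(2) by (auto simp: PiE_iff extensional_def)
    from fib[OF this] have "card {x\<in>X. P (g(z := x))} \<le> B" by simp
    moreover have "card ((\<lambda>x. g(z := x)) ` {x\<in>X. P (g(z := x))}) \<le> card {x\<in>X. P (g(z := x))}"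
      using assms(3) by (intro card_image_le) auto
    ultimately show ?thesis by linarith
  qed simp
  have "card {f \<in> I \<rightarrow>\<^sub>E X. P f} \<le> card (\<Union>g\<in>?F. (\<lambda>x. g(z := x)) ` {x\<in>X. P (g(z := x))})"
    using fin assms(3) by (intro card_mono sub) auto
  also have "\<dots> \<le> (\<Sum>g\<in>?F. card ((\<lambda>x. g(z := x)) ` {x\<in>X. P (g(z := x))}))"
    using fin by (rule card_UN_le)
  also have "\<dots> \<le> (\<Sum>g\<in>?F. B)" by (intro sum_mono le)
  also have "\<dots> = B * card X ^ (card I - 1)"
    using assms by (simp add: card_PiE card_Diff_singleton)
  finally show ?thesis .
qed

text \<open>The numbers \<open>s + x * m\<close> are spaced at least \<open>m\<close> apart and
  confined to an interval of length \<open>2 * \<delta>\<close>; counting both ends produces the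
  \<open>+ 1\<close>.\<close>

lemma card_nat_in_real_interval_le:
  fixes s m \<delta> :: real
  assumes "m > 0" "finite X" "\<And>x. x \<in> X \<Longrightarrow> \<bar>s + real x * m\<bar> \<le> \<delta>" "2 * \<delta> / m \<le> real B"
  shows "card X \<le> B + 1"
proof (cases "X = {}")
  case False
  have "X \<subseteq> {Min X..Min X + B}"
  proof
    fix x assume x: "x \<in> X"
    have Min: "Min X \<in> X" "Min X \<le> x" using False x assms(2) by auto
    have "(real x - real (Min X)) * m \<le> 2 * \<delta>"
      using assms(3)[OF x] assms(3)[OF Min(1)] by (simp add: algebra_simps abs_le_iff)
    then have "real x - real (Min X) \<le> 2 * \<delta> / m" using assms(1) by (simp add: field_simps)
    then show "x \<in> {Min X..Min X + B}" using assms(4) Min by simp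
  qed
  then have "card X \<le> card {Min X..Min X + B}" by (intro card_mono) auto
  then show ?thesis by simp
qed simp

section \<open>Generic recolouring\<close>

definition measurable_coloring :: "nat \<Rightarrow> (real^'n \<Rightarrow> nat) \<Rightarrow> bool" where
  "measurable_coloring k c \<longleftrightarrow> (\<forall>x. c x \<in> {1..k}) \<and> (\<forall>j\<in>{1..k}. c -` {j} \<in> sets lebesgue)"

text \<open>Zero exactly when \<open>U\<close> contains half of the measure of \<open>A \<inter> Q\<close>.\<close>
definition imbalance :: "(real^'n) set \<Rightarrow> (real^'n) set \<Rightarrow> (real^'n) set \<Rightarrow> real" where
  "imbalance Q U A = 2 * measure lebesgue (A \<inter> U) - measure lebesgue (A \<inter> Q)"

lemma imbalance_Un:
  assumes "Q \<in> lmeasurable" "U \<in> lmeasurable" "A \<in> sets lebesgue" "B \<in> sets lebesgue" "A \<inter> B = {}"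
  shows "imbalance Q U (A \<union> B) = imbalance Q U A + imbalance Q U B"
proof -
  have add: "measure lebesgue ((A \<union> B) \<inter> V) = measure lebesgue (A \<inter> V) + measure lebesgue (B \<inter> V)"
    if "V \<in> lmeasurable" for V
  proof -
    have "(A \<union> B) \<inter> V = (A \<inter> V) \<union> (B \<inter> V)" by auto
    moreover have "A \<inter> V \<in> lmeasurable" "B \<inter> V \<in> lmeasurable"
      using that assms(3,4) by (auto intro: fmeasurable_Int_fmeasurable simp: Int_commute[of _ V])
    moreover have "(A \<inter> V) \<inter> (B \<inter> V) = {}" using assms(5) by auto
    ultimately show ?thesis by (simp add: measure_Un3)
  qed
  show ?thesis using add[OF assms(1)] add[OF assms(2)] unfolding imbalance_def by linarith
qed

lemma imbalance_UN:
  assumes "Q \<in> lmeasurable" "U \<in> lmeasurable" "finite I"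
    and "\<And>i. i \<in> I \<Longrightarrow> A i \<in> sets lebesgue" "disjoint_family_on A I"
  shows "imbalance Q U (\<Union>i\<in>I. A i) = (\<Sum>i\<in>I. imbalance Q U (A i))"
  using assms(3-)
proof (induction I rule: finite_induct)
  case empty
  then show ?case by (simp add: imbalance_def)
next
  case (insert i I)
  have "A i \<inter> (\<Union>l\<in>I. A l) = {}"
    using insert.prems(2) insert.hyps unfolding disjoint_family_on_def by fastforce
  moreover have "(\<Union>l\<in>I. A l) \<in> sets lebesgue" using insert by (intro sets.finite_UN) auto
  moreover have "disjoint_family_on A I"
    using insert.prems(2) by (auto simp: disjoint_family_on_def)
  ultimately show ?case
    using insert assms(1,2) by (simp add: imbalance_Un)
qed

section \<open>Stability of the imbalance under small changes of the sets\<close>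

lemma abs_measure_diff_le:
  assumes "A \<in> lmeasurable" "B \<in> lmeasurable" "C \<in> lmeasurable" "(A - B) \<union> (B - A) \<subseteq> C"
  shows "\<bar>measure lebesgue A - measure lebesgue B\<bar> \<le> measure lebesgue C"
proof -
  have "measure lebesgue A \<le> measure lebesgue (B \<union> C)"
    using assms by (intro measure_mono_fmeasurable) (auto intro: fmeasurable.Un)
  also have "\<dots> \<le> measure lebesgue B + measure lebesgue C"
    using assms by (intro measure_Un_le) auto
  finally have 1: "measure lebesgue A \<le> measure lebesgue B + measure lebesgue C" .
  have "measure lebesgue B \<le> measure lebesgue (A \<union> C)"
    using assms by (intro measure_mono_fmeasurable) (auto intro: fmeasurable.Un)
  also have "\<dots> \<le> measure lebesgue A + measure lebesgue C"
    using assms by (intro measure_Un_le) auto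
  finally show ?thesis using 1 by linarith
qed

text \<open>Here the colour class is fixed and the test pair moves, as when parameters are rounded.
  The factor 3 is 2 from the \<open>U\<close> term plus 1 from the \<open>Q\<close> term of the
  imbalance.\<close>

lemma imbalance_sets_diff_le:
  assumes "Q \<in> lmeasurable" "U \<in> lmeasurable" "Q' \<in> lmeasurable" "U' \<in> lmeasurable"
    and "A \<in> sets lebesgue" "C \<in> lmeasurable"
    and "(Q - Q') \<union> (Q' - Q) \<subseteq> C" "(U - U') \<union> (U' - U) \<subseteq> C"
  shows "\<bar>imbalance Q U A - imbalance Q' U' A\<bar> \<le> 3 * measure lebesgue C"
proof -
  have m: "A \<inter> V \<in> lmeasurable" if "V \<in> lmeasurable" for V
    using that assms(5) by (auto intro: fmeasurable_Int_fmeasurable simp: Int_commute[of _ V])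
  have "\<bar>measure lebesgue (A \<inter> Q) - measure lebesgue (A \<inter> Q')\<bar> \<le> measure lebesgue C"
    by (rule abs_measure_diff_le) (use m assms in blast)+
  moreover have "\<bar>measure lebesgue (A \<inter> U) - measure lebesgue (A \<inter> U')\<bar> \<le> measure lebesgue C"
    by (rule abs_measure_diff_le) (use m assms in blast)+
  ultimately show ?thesis unfolding imbalance_def by linarith
qed

text \<open>The counterpart with a fixed test pair and a colour class that changes inside
  \<open>C\<close>. It transfers a margin from one stage of the construction to the limit
  colouring.\<close>

lemma imbalance_class_diff_le:
  assumes "Q \<in> lmeasurable" "U \<in> lmeasurable" "A \<in> sets lebesgue" "B \<in> sets lebesgue"
    and "C \<in> lmeasurable" "(A - B) \<union> (B - A) \<subseteq> C"
  shows "\<bar>imbalance Q U A - imbalance Q U B\<bar> \<le> 3 * measure lebesgue C"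
proof -
  have m: "A \<inter> V \<in> lmeasurable" "B \<inter> V \<in> lmeasurable" if "V \<in> lmeasurable" for V
    using that assms(3,4) by (auto intro: fmeasurable_Int_fmeasurable simp: Int_commute[of _ V])
  have "\<bar>measure lebesgue (A \<inter> Q) - measure lebesgue (B \<inter> Q)\<bar> \<le> measure lebesgue C"
    by (rule abs_measure_diff_le) (use m assms in blast)+
  moreover have "\<bar>measure lebesgue (A \<inter> U) - measure lebesgue (B \<inter> U)\<bar> \<le> measure lebesgue C"
    by (rule abs_measure_diff_le) (use m assms in blast)+
  ultimately show ?thesis unfolding imbalance_def by linarith
qed

text \<open>A set inside an uncut cell counts with one sign only. This is the source of the affine
  dependence on the amount painted in that cell, with a slope of known absolute value.\<close>

lemma imbalance_uncut:
  assumes "A \<subseteq> G" "G \<subseteq> Q" "G \<subseteq> U \<or> G \<inter> U = {}"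
  shows "imbalance Q U A = (if G \<subseteq> U then 1 else -1) * measure lebesgue A"
proof -
  have "A \<inter> Q = A" "G \<subseteq> U \<Longrightarrow> A \<inter> U = A" "\<not> G \<subseteq> U \<Longrightarrow> A \<inter> U = {}" using assms by auto
  then show ?thesis by (simp add: imbalance_def)
qed

text \<open>
  Inside each cell \<open>G z\<close> and for each colour \<open>j < k\<close> we reserve \<open>q\<close> pieces of equal measure, of which
  \<open>\<theta> j z\<close> are painted \<open>j\<close> and the others \<open>k\<close>. A test pair \<open>(U, Q)\<close> leaves some cell uncut; with the
  parameters of the other cells fixed, the imbalance of colour \<open>j\<close> is affine in the parameter of that
  cell, so being nearly balanced in all \<open>k - 1\<close> colours leaves only a fraction \<open>O(q ^ -(k-1))\<close> of all \<open>\<theta>\<close>.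
  The test pairs fall into \<open>O(q ^ D)\<close> classes, and \<open>D < k - 1\<close>.
\<close>
lemma generic_recoloring:
  fixes c :: "real^'n::finite \<Rightarrow> nat" and G :: "'z \<Rightarrow> (real^'n) set"
    and W :: "'w set" and Q U :: "'w \<Rightarrow> (real^'n) set" and R :: "nat \<Rightarrow> 'w \<Rightarrow> 'r"
  assumes col: "measurable_coloring k c"
    and Z: "finite Z" "disjoint_family_on G Z"
      "\<And>z. z \<in> Z \<Longrightarrow> G z \<in> lmeasurable \<and> bounded (G z) \<and> measure lebesgue (G z) > 0"
    and QU: "\<And>w. w \<in> W \<Longrightarrow> Q w \<in> lmeasurable \<and> U w \<in> lmeasurable"
    and uncut: "\<And>w. w \<in> W \<Longrightarrow> \<exists>z\<in>Z. G z \<subseteq> Q w \<and> (G z \<subseteq> U w \<or> G z \<inter> U w = {})"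
    and R: "\<And>q. q \<ge> 1 \<Longrightarrow> finite (R q ` W) \<and> card (R q ` W) \<le> C * q ^ D"
    and close: "\<And>q w w' A. q \<ge> 1 \<Longrightarrow> w \<in> W \<Longrightarrow> w' \<in> W \<Longrightarrow> R q w = R q w' \<Longrightarrow> A \<in> sets lebesgue \<Longrightarrow>
        \<bar>imbalance (Q w) (U w) A - imbalance (Q w') (U w') A\<bar> \<le> L / real q"
    and L: "L > 0" and k: "D + 2 \<le> k" and e: "e > 0"
  shows "\<exists>c' X \<delta>. measurable_coloring k c' \<and> X \<in> lmeasurable \<and> measure lebesgue X \<le> e \<and>
           (\<forall>x. x \<notin> X \<longrightarrow> c' x = c x) \<and> \<delta> > 0 \<and>
           (\<forall>w\<in>W. \<exists>j\<in>{1..k}. \<delta> \<le> \<bar>imbalance (Q w) (U w) (c' -` {j})\<bar>)"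
proof (cases "W = {}")
  case True
  then show ?thesis using col e by (intro exI[of _ c] exI[of _ "{}"] exI[of _ 1]) auto
next
  case False
  then have "Z \<noteq> {}" using uncut by blast
  define J where "J = {1..<k}"
  have cJ: "card J = k - 1" "finite J" by (auto simp: J_def)
  have "card J \<ge> 1" using cJ k by simp
  \<comment> \<open>\<open>m0\<close> is the measure reserved per colour and cell. It must fit
    \<open>card J\<close> times into the smallest cell, and the reserves of all cells together must
    not exceed \<open>e\<close>.\<close>
  obtain m0 where m0: "m0 > 0" "real (card J) * m0 * real (card Z) \<le> e"
      "\<And>z. z \<in> Z \<Longrightarrow> real (card J) * m0 \<le> measure lebesgue (G z)"
  proof -
    define \<mu> where "\<mu> = Min ((\<lambda>z. measure lebesgue (G z)) ` Z)"
    have "\<mu> > 0" unfolding \<mu>_def using Z \<open>Z \<noteq> {}\<close> by (subst Min_gr_iff) auto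
    have \<mu>: "\<mu> \<le> measure lebesgue (G z)" if "z \<in> Z" for z
      unfolding \<mu>_def using Z that by (intro Min_le) auto
    define m0 where "m0 = min \<mu> (e / real (card Z)) / real (card J)"
    have "card Z > 0" using Z \<open>Z \<noteq> {}\<close> by (simp add: card_gt_0_iff)
    have Jm: "real (card J) * m0 = min \<mu> (e / real (card Z))"
      using \<open>card J \<ge> 1\<close> by (simp add: m0_def)
    show ?thesis
    proof (rule that)
      show "m0 > 0" using \<open>\<mu> > 0\<close> e \<open>card Z > 0\<close> \<open>card J \<ge> 1\<close> by (simp add: m0_def)
      have "real (card J) * m0 * real (card Z) \<le> (e / real (card Z)) * real (card Z)"
        unfolding Jm by (intro mult_right_mono) auto
      then show "real (card J) * m0 * real (card Z) \<le> e" using \<open>card Z > 0\<close> by simp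
      show "real (card J) * m0 \<le> measure lebesgue (G z)" if "z \<in> Z" for z
        unfolding Jm using \<mu>[OF that] by simp
    qed
  qed
  \<comment> \<open>Amounts vary in steps of \<open>m0 / q\<close> and the tolerance is
    \<open>2 * L / q\<close>, so \<open>q\<close> cancels and at most \<open>B\<close> amounts are
    nearly balanced. Because \<open>B\<close> does not depend on \<open>q\<close>, the latter can be
    chosen afterwards, just above \<open>C * B ^ card J\<close>.\<close>
  define B where "B = nat \<lceil>4 * L / m0\<rceil> + 1"
  define q where "q = C * B ^ card J + 1"
  have "q \<ge> 1" by (simp add: q_def)
  then have q: "q \<ge> 1" "real q > 0" by auto
  define m where "m = m0 / real q"
  have m: "m > 0" using m0 q by (simp add: m_def)
  have "\<forall>z\<in>Z. \<exists>T. disjoint_family_on T (J \<times> {..<q}) \<and>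
     (\<forall>i\<in>J \<times> {..<q}. T i \<subseteq> G z \<and> T i \<in> lmeasurable \<and> measure lebesgue (T i) = m)"
  proof
    fix z assume z: "z \<in> Z"
    have "real (card (J \<times> {..<q})) * m = real (card J) * m0"
      using q by (simp add: card_cartesian_product m_def)
    then show "\<exists>T. disjoint_family_on T (J \<times> {..<q}) \<and>
     (\<forall>i\<in>J \<times> {..<q}. T i \<subseteq> G z \<and> T i \<in> lmeasurable \<and> measure lebesgue (T i) = m)"
      using Z(3)[OF z] m0(3)[OF z] m cJ by (intro lmeasurable_equal_pieces) auto
  qed
  then obtain T0 where T0: "\<And>z. z \<in> Z \<Longrightarrow> disjoint_family_on (T0 z) (J \<times> {..<q})"
    "\<And>z i. z \<in> Z \<Longrightarrow> i \<in> J \<times> {..<q} \<Longrightarrow>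
        T0 z i \<subseteq> G z \<and> T0 z i \<in> lmeasurable \<and> measure lebesgue (T0 z i) = m"
    by metis
  define T where "T = (\<lambda>(z, i). T0 z i)"
  define I where "I = Z \<times> (J \<times> {..<q})"
  have finI: "finite I" using Z cJ by (simp add: I_def)
  have T: "T (z, i) \<subseteq> G z" "T (z, i) \<in> lmeasurable" "measure lebesgue (T (z, i)) = m"
    if "(z, i) \<in> I" for z i
    using that T0(2) by (auto simp: T_def I_def)
  have disjT: "disjoint_family_on T I"
    unfolding disjoint_family_on_def
  proof (intro ballI impI)
    fix a b assume ab: "a \<in> I" "b \<in> I" "a \<noteq> b"
    obtain z i where a: "a = (z, i)" by (cases a)
    obtain z' i' where b: "b = (z', i')" by (cases b)
    have mem: "z \<in> Z" "z' \<in> Z" "i \<in> J \<times> {..<q}" "i' \<in> J \<times> {..<q}"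
      using ab(1,2) unfolding a b I_def by blast+
    show "T a \<inter> T b = {}"
    proof (cases "z = z'")
      case True
      then have "i \<noteq> i'" using ab(3) a b by blast
      then have "T0 z i \<inter> T0 z i' = {}"
        using disjoint_family_onD[OF T0(1)[OF mem(1)] mem(3,4)] by blast
      then show ?thesis unfolding a b T_def using True by simp
    next
      case False
      then have "G z \<inter> G z' = {}" using disjoint_family_onD[OF Z(2) mem(1,2)] by blast
      then show ?thesis using T(1) ab(1,2) unfolding a b by blast
    qed
  qed
  define X where "X = (\<Union>a\<in>I. T a)"
  have X: "X \<in> lmeasurable" unfolding X_def using finI T(2) by (intro fmeasurable.finite_UN) auto
  have "measure lebesgue X \<le> (\<Sum>a\<in>I. measure lebesgue (T a))"
    unfolding X_def using finI T(2) by (intro measure_UNION_le) (auto dest!: fmeasurableD)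
  also have "\<dots> = (\<Sum>a\<in>I. m)" using T(3) by (intro sum.cong) auto
  also have "\<dots> = real (card J) * m0 * real (card Z)"
    using q by (simp add: I_def card_cartesian_product m_def)
  finally have Xe: "measure lebesgue X \<le> e" using m0(2) by simp
  define \<kappa> where "\<kappa> x = (SOME a. a \<in> I \<and> x \<in> T a)" for x
  have \<kappa>: "\<kappa> x = a" if "a \<in> I" "x \<in> T a" for x a
  proof -
    have "\<kappa> x \<in> I \<and> x \<in> T (\<kappa> x)" unfolding \<kappa>_def by (rule someI[of _ a]) (use that in auto)
    then show ?thesis using disjT that unfolding disjoint_family_on_def by blast
  qed
  define c' where "c' \<theta> x = (if x \<in> X then case \<kappa> x of (z, j, l) \<Rightarrow> if l < \<theta> j z then j else k else c x)"
    for \<theta> :: "nat \<Rightarrow> 'z \<Rightarrow> nat" and x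
  define P where "P z j n = (\<Union>l<n. T (z, j, l))" for z j and n :: nat
  have Pmeas: "P z j n \<in> lmeasurable" "P z j n \<subseteq> G z" "measure lebesgue (P z j n) = real n * m"
    if "z \<in> Z" "j \<in> J" "n \<le> q" for z j n
  proof -
    have I: "(z, j, l) \<in> I" if "l < n" for l using that \<open>z \<in> Z\<close> \<open>j \<in> J\<close> \<open>n \<le> q\<close> by (auto simp: I_def)
    show "P z j n \<in> lmeasurable" unfolding P_def using T(2) I by (intro fmeasurable.finite_UN) auto
    show "P z j n \<subseteq> G z" unfolding P_def using T(1) I by blast
    have "measure lebesgue (P z j n) = (\<Sum>l<n. measure lebesgue (T (z, j, l)))"
      unfolding P_def
    proof (rule measure_finite_Union)
      show "disjoint_family_on (\<lambda>l. T (z, j, l)) {..<n}"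
        using disjT I unfolding disjoint_family_on_def by auto
      show "emeasure lebesgue (T (z, j, l)) \<noteq> \<infinity>" if "l \<in> {..<n}" for l
        using fmeasurableD2[OF T(2)[OF I]] that by simp
    qed (use T(2) I in \<open>auto dest!: fmeasurableD\<close>)
    then show "measure lebesgue (P z j n) = real n * m" using T(3) I by simp
  qed
  define \<Theta> where "\<Theta> = J \<rightarrow>\<^sub>E (Z \<rightarrow>\<^sub>E {..<q})"
  have fin\<Phi>: "finite (Z \<rightarrow>\<^sub>E {..<q})" using Z by (intro finite_PiE) auto
  have fin\<Theta>: "finite \<Theta>" unfolding \<Theta>_def using cJ(2) fin\<Phi> by (simp add: finite_PiE)
  have th: "\<theta> j z < q" if "\<theta> \<in> \<Theta>" "j \<in> J" "z \<in> Z" for \<theta> j z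
    using PiE_mem[OF PiE_mem[OF that(1)[unfolded \<Theta>_def] that(2)] that(3)] by simp
  \<comment> \<open>This description is for \<open>j < k\<close>. Colour \<open>k\<close> receives
    all leftover pieces, and its measurability is obtained below by passing to a complement.\<close>
  have vimage_c': "c' \<theta> -` {j} = (c -` {j} - X) \<union> (\<Union>z\<in>Z. P z j (\<theta> j z))" if "\<theta> \<in> \<Theta>" "j \<in> J" for \<theta> j
  proof -
    have inX: "x \<in> c' \<theta> -` {j} \<longleftrightarrow> x \<in> (\<Union>z\<in>Z. P z j (\<theta> j z))" if x: "x \<in> X" for x
    proof -
      obtain z' j' l' where a: "(z', j', l') \<in> I" "x \<in> T (z', j', l')"
        using x by (auto simp: X_def)
      have "x \<in> c' \<theta> -` {j} \<longleftrightarrow> l' < \<theta> j' z' \<and> j' = j"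
        using \<kappa>[OF a] x a \<open>j \<in> J\<close> by (auto simp: c'_def J_def)
      also have "\<dots> \<longleftrightarrow> x \<in> (\<Union>z\<in>Z. P z j (\<theta> j z))"
      proof
        assume "l' < \<theta> j' z' \<and> j' = j"
        then show "x \<in> (\<Union>z\<in>Z. P z j (\<theta> j z))" using a by (auto simp: P_def I_def)
      next
        assume "x \<in> (\<Union>z\<in>Z. P z j (\<theta> j z))"
        then obtain z l where b: "z \<in> Z" "l < \<theta> j z" "x \<in> T (z, j, l)" by (auto simp: P_def)
        then have "(z, j, l) \<in> I" using th[OF \<open>\<theta> \<in> \<Theta>\<close> \<open>j \<in> J\<close> b(1)] \<open>j \<in> J\<close> by (simp add: I_def)
        from \<kappa>[OF this b(3)] \<kappa>[OF a] b show "l' < \<theta> j' z' \<and> j' = j" by auto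
      qed
      finally show ?thesis .
    qed
    have PX: "(\<Union>z\<in>Z. P z j (\<theta> j z)) \<subseteq> X"
    proof
      fix x assume "x \<in> (\<Union>z\<in>Z. P z j (\<theta> j z))"
      then obtain z l where b: "z \<in> Z" "l < \<theta> j z" "x \<in> T (z, j, l)" by (auto simp: P_def)
      then have "(z, j, l) \<in> I" using th[OF \<open>\<theta> \<in> \<Theta>\<close> \<open>j \<in> J\<close> b(1)] \<open>j \<in> J\<close> by (simp add: I_def)
      then show "x \<in> X" using b by (auto simp: X_def)
    qed
    have offX: "x \<in> c' \<theta> -` {j} \<longleftrightarrow> x \<in> c -` {j}" if "x \<notin> X" for x using that by (simp add: c'_def)
    show ?thesis
    proof (rule set_eqI)
      fix x
      show "x \<in> c' \<theta> -` {j} \<longleftrightarrow> x \<in> (c -` {j} - X) \<union> (\<Union>z\<in>Z. P z j (\<theta> j z))"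
        using inX[of x] offX[of x] subsetD[OF PX, of x] unfolding Un_iff Diff_iff by argo
    qed
  qed
  have cmeas: "c -` {j} - X \<in> sets lebesgue" for j
  proof -
    have "c -` {j} \<in> sets lebesgue"
    proof (cases "j \<in> {1..k}")
      case True then show ?thesis using col by (auto simp: measurable_coloring_def)
    next
      case False
      then have "c -` {j} = {}" using col by (auto simp: measurable_coloring_def)
      then show ?thesis by simp
    qed
    then show ?thesis using X by (auto dest!: fmeasurableD)
  qed
  have Pun: "(\<Union>z\<in>Z. P z j (\<theta> j z)) \<in> sets lebesgue" if "\<theta> \<in> \<Theta>" "j \<in> J" for \<theta> j
  proof -
    have "\<theta> j z \<le> q" if "z \<in> Z" for z
      using th[OF \<open>\<theta> \<in> \<Theta>\<close> \<open>j \<in> J\<close> that] by simp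
    then show ?thesis using Z(1) Pmeas(1) that by (intro sets.finite_UN) (auto dest!: fmeasurableD)
  qed
  have meas': "c' \<theta> -` {j} \<in> sets lebesgue" if "\<theta> \<in> \<Theta>" "j \<in> J" for \<theta> j
    unfolding vimage_c'[OF that] using cmeas Pun[OF that] by blast
  have col': "measurable_coloring k (c' \<theta>)" if "\<theta> \<in> \<Theta>" for \<theta>
    unfolding measurable_coloring_def
  proof (intro conjI allI ballI)
    show range: "c' \<theta> x \<in> {1..k}" for x
    proof (cases "x \<in> X")
      case True
      then obtain z' j' l' where a: "(z', j', l') \<in> I" "x \<in> T (z', j', l')" by (auto simp: X_def)
      then show ?thesis using \<kappa>[OF a] True k by (auto simp: c'_def I_def J_def)
    qed (use col in \<open>auto simp: c'_def measurable_coloring_def\<close>)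
    show "c' \<theta> -` {j} \<in> sets lebesgue" if "j \<in> {1..k}" for j
    proof (cases "j = k")
      case True
      have "c' \<theta> -` {k} = UNIV - (\<Union>j\<in>J. c' \<theta> -` {j})"
        using range by (fastforce simp: J_def)
      moreover have "(\<Union>j\<in>J. c' \<theta> -` {j}) \<in> sets lebesgue"
        using meas'[OF \<open>\<theta> \<in> \<Theta>\<close>] cJ by (intro sets.finite_UN) auto
      then have "UNIV - (\<Union>j\<in>J. c' \<theta> -` {j}) \<in> sets lebesgue"
        using sets.compl_sets[of _ lebesgue] by simp
      ultimately show ?thesis using True by simp
    qed (use meas'[OF \<open>\<theta> \<in> \<Theta>\<close>] that in \<open>auto simp: J_def\<close>)
  qed
  have Lam: "imbalance (Q w) (U w) (c' \<theta> -` {j}) =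
      imbalance (Q w) (U w) (c -` {j} - X) + (\<Sum>z\<in>Z. imbalance (Q w) (U w) (P z j (\<theta> j z)))"
    if "w \<in> W" "\<theta> \<in> \<Theta>" "j \<in> J" for w \<theta> j
  proof -
    have le: "\<theta> j z \<le> q" "\<theta> j z < q" if "z \<in> Z" for z
      using th[OF \<open>\<theta> \<in> \<Theta>\<close> \<open>j \<in> J\<close> that] by simp_all
    have sub: "P z j (\<theta> j z) \<subseteq> X" if "z \<in> Z" for z
      using le(2)[OF that] that \<open>j \<in> J\<close> by (force simp: P_def X_def I_def)
    have "disjoint_family_on (\<lambda>z. P z j (\<theta> j z)) Z"
      unfolding disjoint_family_on_def
    proof (intro ballI impI)
      fix a b assume ab: "a \<in> Z" "b \<in> Z" "a \<noteq> b"
      then have "G a \<inter> G b = {}" using Z(2) by (auto simp: disjoint_family_on_def)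
      then show "P a j (\<theta> j a) \<inter> P b j (\<theta> j b) = {}"
        using Pmeas(2)[OF ab(1) \<open>j \<in> J\<close> le(1)[OF ab(1)]] Pmeas(2)[OF ab(2) \<open>j \<in> J\<close> le(1)[OF ab(2)]] by blast
    qed
    then have "imbalance (Q w) (U w) (\<Union>z\<in>Z. P z j (\<theta> j z)) = (\<Sum>z\<in>Z. imbalance (Q w) (U w) (P z j (\<theta> j z)))"
      using QU[OF that(1)] Z(1) Pmeas(1) le(1) that(3) by (intro imbalance_UN) (auto dest!: fmeasurableD)
    moreover have "(c -` {j} - X) \<inter> (\<Union>z\<in>Z. P z j (\<theta> j z)) = {}" using sub by blast
    ultimately show ?thesis
      unfolding vimage_c'[OF that(2,3)] using QU[OF that(1)] cmeas Pun[OF that(2,3)]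
      by (simp add: imbalance_Un)
  qed
  \<comment> \<open>The threshold is twice the rounding error \<open>L / q\<close>: after passing
    from a representative to an arbitrary test pair, \<open>L / q\<close> is left as margin.\<close>
  define Bad where "Bad w = {\<theta>\<in>\<Theta>. \<forall>j\<in>J. \<bar>imbalance (Q w) (U w) (c' \<theta> -` {j})\<bar> \<le> 2 * L / real q}" for w
  have cardBad: "card (Bad w) \<le> (B * q ^ (card Z - 1)) ^ card J" if w: "w \<in> W" for w
  proof -
    obtain z where z: "z \<in> Z" "G z \<subseteq> Q w" "G z \<subseteq> U w \<or> G z \<inter> U w = {}" using uncut[OF w] by blast
    define \<sigma> :: real where "\<sigma> = (if G z \<subseteq> U w then 1 else -1)"
    have \<sigma>: "\<sigma> = 1 \<or> \<sigma> = -1" by (simp add: \<sigma>_def)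
    \<comment> \<open>\<open>F j\<close> depends only on the row \<open>\<theta> j\<close>, so the
      conditions for different colours are independent and the bad set lies in a product.\<close>
    define F where "F j \<phi> = imbalance (Q w) (U w) (c -` {j} - X) + (\<Sum>z\<in>Z. imbalance (Q w) (U w) (P z j (\<phi> z)))"
      for j and \<phi> :: "'z \<Rightarrow> nat"
    define Bj where "Bj j = {\<phi> \<in> Z \<rightarrow>\<^sub>E {..<q}. \<bar>F j \<phi>\<bar> \<le> 2 * L / real q}" for j
    have "Bad w \<subseteq> PiE J Bj"
    proof
      fix \<theta> assume "\<theta> \<in> Bad w"
      then have \<theta>: "\<theta> \<in> \<Theta>" "\<And>j. j \<in> J \<Longrightarrow> \<bar>imbalance (Q w) (U w) (c' \<theta> -` {j})\<bar> \<le> 2 * L / real q"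
        by (simp_all add: Bad_def)
      show "\<theta> \<in> PiE J Bj"
      proof (rule PiE_I)
        fix j assume j: "j \<in> J"
        have "\<theta> j \<in> Z \<rightarrow>\<^sub>E {..<q}" using PiE_mem[OF \<theta>(1)[unfolded \<Theta>_def] j] .
        then show "\<theta> j \<in> Bj j" using \<theta>(2)[OF j] unfolding Bj_def F_def Lam[OF w \<theta>(1) j] by blast
      next
        fix j assume "j \<notin> J"
        then show "\<theta> j = undefined" using \<theta>(1) PiE_arb unfolding \<Theta>_def by metis
      qed
    qed
    moreover have finB: "finite (Bj j)" for j unfolding Bj_def using fin\<Phi> by auto
    ultimately have "card (Bad w) \<le> card (PiE J Bj)"
      using cJ(2) by (simp add: card_mono finite_PiE)
    also have "\<dots> = (\<Prod>j\<in>J. card (Bj j))" using cJ by (simp add: card_PiE)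
    also have "\<dots> \<le> (\<Prod>j\<in>J. B * q ^ (card Z - 1))"
    proof (intro prod_mono conjI)
      fix j assume j: "j \<in> J"
      have "card {\<phi> \<in> Z \<rightarrow>\<^sub>E {..<q}. \<bar>F j \<phi>\<bar> \<le> 2 * L / real q} \<le> B * card {..<q} ^ (card Z - 1)"
      proof (rule card_PiE_le_by_fibers)
        fix \<phi> assume \<phi>: "\<phi> \<in> Z \<rightarrow>\<^sub>E {..<q}"
        \<comment> \<open>Everything that does not come from the uncut cell \<open>z\<close>: the
          intercept of the affine function of \<open>x\<close>.\<close>
        define s where "s = imbalance (Q w) (U w) (c -` {j} - X) + (\<Sum>z\<in>Z-{z}. imbalance (Q w) (U w) (P z j (\<phi> z)))"
        have eq: "F j (\<phi>(z := x)) = s + \<sigma> * (real x * m)" if "x < q" for x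
        proof -
          have "imbalance (Q w) (U w) (P z j x) = \<sigma> * (real x * m)"
            using imbalance_uncut[of "P z j x" "G z" "Q w" "U w"] z Pmeas[OF z(1) j, of x] that
            by (simp add: \<sigma>_def)
          then show ?thesis unfolding F_def s_def using Z(1) z(1)
            by (subst sum.remove[of _ z]) (auto intro!: sum.cong)
        qed
        show "card {x \<in> {..<q}. \<bar>F j (\<phi>(z := x))\<bar> \<le> 2 * L / real q} \<le> B"
          unfolding B_def
        proof (rule card_nat_in_real_interval_le[of m _ "\<sigma> * s"])
          fix x assume x: "x \<in> {x \<in> {..<q}. \<bar>F j (\<phi>(z := x))\<bar> \<le> 2 * L / real q}"
          have "\<bar>\<sigma> * s + real x * m\<bar> = \<bar>F j (\<phi>(z := x))\<bar>" using \<sigma> x eq by auto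
          then show "\<bar>\<sigma> * s + real x * m\<bar> \<le> 2 * L / real q" using x by simp
        next
          have "2 * (2 * L / real q) / m = 4 * L / m0" using q by (simp add: m_def)
          then show "2 * (2 * L / real q) / m \<le> real (nat \<lceil>4 * L / m0\<rceil>)" by linarith
        qed (use m in auto)
      qed (use Z z in auto)
      then show "card (Bj j) \<le> B * q ^ (card Z - 1)" by (simp add: Bj_def)
    qed auto
    finally show ?thesis by simp
  qed
  define rep where "rep \<rho> = (SOME w. w \<in> W \<and> R q w = \<rho>)" for \<rho>
  have rep: "rep \<rho> \<in> W" "R q (rep \<rho>) = \<rho>" if "\<rho> \<in> R q ` W" for \<rho>
    using someI_ex[of "\<lambda>w. w \<in> W \<and> R q w = \<rho>"] that by (auto simp: rep_def)
  have "card (\<Union>\<rho>\<in>R q ` W. Bad (rep \<rho>)) \<le> (\<Sum>\<rho>\<in>R q ` W. card (Bad (rep \<rho>)))"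
    using R[OF q(1)] by (intro card_UN_le) auto
  also have "\<dots> \<le> (\<Sum>\<rho>\<in>R q ` W. (B * q ^ (card Z - 1)) ^ card J)"
    by (intro sum_mono cardBad rep)
  also have "\<dots> = card (R q ` W) * (B * q ^ (card Z - 1)) ^ card J" by simp
  also have "\<dots> \<le> (C * q ^ D) * (B * q ^ (card Z - 1)) ^ card J"
    using R[OF q(1)] by (intro mult_right_mono) auto
  also have "\<dots> = (C * B ^ card J) * q ^ D * (q ^ (card Z - 1)) ^ card J"
    by (simp add: power_mult_distrib)
  also have "\<dots> < q * q ^ D * (q ^ (card Z - 1)) ^ card J"
    using q by (intro mult_strict_right_mono) (auto simp: q_def)
  \<comment> \<open>Here the hypothesis on \<open>k\<close> enters: \<open>card J = k - 1\<close> is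
    at least \<open>D + 1\<close>. One factor \<open>q\<close> has absorbed the constant
    \<open>C * B ^ card J\<close>, the other \<open>D\<close> pay for the number of classes.\<close>
  also have "\<dots> \<le> q ^ card J * (q ^ (card Z - 1)) ^ card J"
  proof -
    have "q ^ Suc D \<le> q ^ card J" using q k cJ by (intro power_increasing) auto
    then show ?thesis by (intro mult_right_mono) auto
  qed
  also have "\<dots> = (q ^ card Z) ^ card J"
  proof -
    have "q * q ^ (card Z - 1) = q ^ card Z"
      using Z(1) \<open>Z \<noteq> {}\<close> by (metis card_gt_0_iff power_minus_mult mult.commute)
    then show ?thesis by (metis power_mult_distrib)
  qed
  also have "\<dots> = card \<Theta>" unfolding \<Theta>_def using cJ Z(1) by (simp add: card_PiE)
  finally have lt: "card (\<Union>\<rho>\<in>R q ` W. Bad (rep \<rho>)) < card \<Theta>" .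
  have "(\<Union>\<rho>\<in>R q ` W. Bad (rep \<rho>)) \<subseteq> \<Theta>" unfolding Bad_def by blast
  then have "\<not> \<Theta> \<subseteq> (\<Union>\<rho>\<in>R q ` W. Bad (rep \<rho>))" using lt by (metis less_irrefl subset_antisym)
  then obtain \<theta> where \<theta>: "\<theta> \<in> \<Theta>" "\<And>\<rho>. \<rho> \<in> R q ` W \<Longrightarrow> \<theta> \<notin> Bad (rep \<rho>)" by blast
  have good: "\<exists>j\<in>{1..k}. L / real q \<le> \<bar>imbalance (Q w) (U w) (c' \<theta> -` {j})\<bar>" if w: "w \<in> W" for w
  proof -
    let ?w = "rep (R q w)"
    have r: "?w \<in> W" "R q w = R q ?w" using rep[of "R q w"] w by auto
    obtain j where j: "j \<in> J" "\<bar>imbalance (Q ?w) (U ?w) (c' \<theta> -` {j})\<bar> > 2 * L / real q"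
      using \<theta>(2)[of "R q w"] \<theta>(1) w by (auto simp: Bad_def not_le)
    have "\<bar>imbalance (Q w) (U w) (c' \<theta> -` {j}) - imbalance (Q ?w) (U ?w) (c' \<theta> -` {j})\<bar> \<le> L / real q"
      using close[OF q(1) w r] meas'[OF \<theta>(1) j(1)] by blast
    moreover have "2 * L / real q = L / real q + L / real q" by simp
    ultimately have "L / real q \<le> \<bar>imbalance (Q w) (U w) (c' \<theta> -` {j})\<bar>" using j(2) by linarith
    then show ?thesis using j(1) by (auto simp: J_def)
  qed
  show ?thesis
  proof (intro exI conjI)
    show "measurable_coloring k (c' \<theta>)" by (rule col'[OF \<theta>(1)])
    show "\<forall>x. x \<notin> X \<longrightarrow> c' \<theta> x = c x" by (simp add: c'_def)
    show "L / real q > 0" using L q by simp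
  qed (use X Xe good in auto)
qed

section \<open>The limit colouring\<close>

text \<open>Later changes shrink geometrically and are tied to the margin just obtained. If a stage
  leaves margin \<open>12 * e'\<close>, all subsequent changes have total measure at most
  \<open>2 * e'\<close> and shift an imbalance by at most \<open>6 * e'\<close>.\<close>

lemma limit_coloring:
  fixes W :: "nat \<Rightarrow> 'w set" and Q U :: "'w \<Rightarrow> (real^'n::finite) set"
  assumes k: "k \<ge> 1"
    and QU: "\<And>n w. w \<in> W n \<Longrightarrow> Q w \<in> lmeasurable \<and> U w \<in> lmeasurable"
    and step: "\<And>n c e. measurable_coloring k c \<Longrightarrow> e > 0 \<Longrightarrow>
        \<exists>c' X \<delta>. measurable_coloring k c' \<and> X \<in> lmeasurable \<and> measure lebesgue X \<le> e \<and>
           (\<forall>x. x \<notin> X \<longrightarrow> c' x = c x) \<and> \<delta> > 0 \<and>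
           (\<forall>w\<in>W n. \<exists>j\<in>{1..k}. \<delta> \<le> \<bar>imbalance (Q w) (U w) (c' -` {j})\<bar>)"
  shows "\<exists>c. measurable_coloring k c \<and>
           (\<forall>n. \<forall>w\<in>W n. \<exists>j\<in>{1..k}. imbalance (Q w) (U w) (c -` {j}) \<noteq> 0)"
proof -
  \<comment> \<open>A state is a colouring together with a bound on the measure of the set to be
    changed in the next step.\<close>
  let ?P = "\<lambda>s :: (real^'n \<Rightarrow> nat) \<times> real. measurable_coloring k (fst s) \<and> snd s > 0"
  let ?S = "\<lambda>n (s :: (real^'n \<Rightarrow> nat) \<times> real) s'. \<exists>X \<in> lmeasurable. measure lebesgue X \<le> snd s \<and>
     (\<forall>x. x \<notin> X \<longrightarrow> fst s' x = fst s x) \<and> snd s' \<le> snd s / 2 \<and>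
     (\<forall>w\<in>W n. \<exists>j\<in>{1..k}. 12 * snd s' \<le> \<bar>imbalance (Q w) (U w) (fst s' -` {j})\<bar>)"
  have "\<exists>f. \<forall>n. ?P (f n) \<and> ?S n (f n) (f (Suc n))"
  proof (rule dependent_nat_choice[where P = "\<lambda>_. ?P" and Q = ?S])
    have "measurable_coloring k (\<lambda>_::real^'n. 1)"
      using k by (auto simp: measurable_coloring_def vimage_const)
    then show "\<exists>s. ?P s" by (intro exI[of _ "(\<lambda>_. 1, 1)"]) auto
  next
    fix s n assume s: "?P s"
    obtain c e where [simp]: "s = (c, e)" by (cases s)
    obtain c' X \<delta> where c': "measurable_coloring k c'" "X \<in> lmeasurable" "measure lebesgue X \<le> e"
      "\<forall>x. x \<notin> X \<longrightarrow> c' x = c x" "\<delta> > 0"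
      "\<forall>w\<in>W n. \<exists>j\<in>{1..k}. \<delta> \<le> \<bar>imbalance (Q w) (U w) (c' -` {j})\<bar>"
      using step[of c e n] s by auto
    define e' where "e' = min (e / 2) (\<delta> / 12)"
    have e': "e' > 0" "e' \<le> e / 2" "12 * e' \<le> \<delta>" using s c'(5) by (auto simp: e'_def)
    have "\<forall>w\<in>W n. \<exists>j\<in>{1..k}. 12 * e' \<le> \<bar>imbalance (Q w) (U w) (c' -` {j})\<bar>"
      using c'(6) e'(3) by (meson order_trans)
    then show "\<exists>s'. ?P s' \<and> ?S n s s'"
      using c' e' by (intro exI[of _ "(c', e')"]) auto
  qed
  then obtain f where f: "\<And>n. ?P (f n)" "\<And>n. ?S n (f n) (f (Suc n))" by blast
  define cs es where "cs = (\<lambda>n. fst (f n))" and "es = (\<lambda>n. snd (f n))"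
  have cs: "measurable_coloring k (cs n)" and es: "es n > 0" for n
    using f(1) by (auto simp: cs_def es_def)
  have "\<exists>X. \<forall>n. X n \<in> lmeasurable \<and> measure lebesgue (X n) \<le> es n \<and> (\<forall>x. x \<notin> X n \<longrightarrow> cs (Suc n) x = cs n x)"
    using f(2) unfolding cs_def es_def by metis
  then obtain X where X: "\<And>n. X n \<in> lmeasurable" "\<And>n. measure lebesgue (X n) \<le> es n"
    "\<And>n x. x \<notin> X n \<Longrightarrow> cs (Suc n) x = cs n x" by blast
  have half: "es (Suc n) \<le> es n / 2" for n using f(2)[of n] by (auto simp: es_def)
  have good: "\<exists>j\<in>{1..k}. 12 * es (Suc n) \<le> \<bar>imbalance (Q w) (U w) (cs (Suc n) -` {j})\<bar>"
    if "w \<in> W n" for n w using f(2)[of n] that by (auto simp: es_def cs_def)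
  have geo: "es (n + i) \<le> es n * (1/2) ^ i" for n i
  proof (induction i)
    case (Suc i)
    then show ?case using half[of "n + i"] by simp
  qed simp
  define Y where "Y n = (\<Union>i. X (n + i))" for n
  have Y: "Y n \<in> lmeasurable" "measure lebesgue (Y n) \<le> 2 * es n" for n
  proof -
    have sum_half: "(\<Sum>i<N. (1/2) ^ i) = 2 - 2 * (1/2 :: real) ^ N" for N :: nat
      by (induction N) auto
    have "(\<Sum>i<N. measure lebesgue (X (n + i))) \<le> 2 * es n" for N
    proof -
      have "(\<Sum>i<N. measure lebesgue (X (n + i))) \<le> (\<Sum>i<N. es n * (1/2) ^ i)"
        using X(2) geo by (intro sum_mono) (meson order_trans)
      also have "\<dots> = es n * (\<Sum>i<N. (1/2) ^ i)" by (simp add: sum_distrib_left)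
      also have "\<dots> = es n * (2 - 2 * (1/2) ^ N)" by (subst sum_half) simp
      also have "\<dots> \<le> es n * 2" using es[of n] by (intro mult_left_mono) auto
      finally show ?thesis by simp
    qed
    then have bd: "measure lebesgue (\<Union>i\<in>I'. X (n + i)) \<le> 2 * es n" if "finite I'" for I' :: "nat set"
    proof -
      obtain N where N: "I' \<subseteq> {..<N}" using \<open>finite I'\<close> finite_nat_iff_bounded by blast
      have "measure lebesgue (\<Union>i\<in>I'. X (n + i)) \<le> (\<Sum>i\<in>I'. measure lebesgue (X (n + i)))"
        using \<open>finite I'\<close> X(1) by (intro measure_UNION_le) (auto dest!: fmeasurableD)
      also have "\<dots> \<le> (\<Sum>i<N. measure lebesgue (X (n + i)))"
        using N by (intro sum_mono2) auto
      finally show ?thesis using \<open>\<And>N. (\<Sum>i<N. measure lebesgue (X (n + i))) \<le> 2 * es n\<close>[of N] by linarith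
    qed
    show "Y n \<in> lmeasurable" "measure lebesgue (Y n) \<le> 2 * es n"
      unfolding Y_def
      by (rule fmeasurable_countable_Union[OF X(1) bd] measure_countable_Union_le[OF X(1) bd], simp)+
  qed
  have const: "cs (n + i) x = cs n x" if "x \<notin> Y n" for n i x
  proof (induction i)
    case (Suc i)
    have "x \<notin> X (n + i)" using that by (auto simp: Y_def)
    then show ?case using X(3) Suc by simp
  qed simp
  \<comment> \<open>Outside the intersection of all \<open>Y n\<close>, which is a null set, the
    colour of a point is eventually constant. On the intersection colour 1 is a default that keeps
    the values within \<open>{1..k}\<close>.\<close>
  define c where "c x = (if \<exists>n. x \<notin> Y n then cs (LEAST n. x \<notin> Y n) x else 1)" for x
  have c_eq: "c x = cs n x" if "x \<notin> Y n" for n x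
  proof -
    let ?N = "LEAST n. x \<notin> Y n"
    have "?N \<le> n" using that by (rule Least_le)
    moreover have "x \<notin> Y ?N" using that by (rule LeastI)
    ultimately have "cs n x = cs ?N x" using const[of x ?N "n - ?N"] by simp
    then show ?thesis using that by (auto simp: c_def)
  qed
  have csm: "cs n -` {j} \<in> sets lebesgue" if "j \<in> {1..k}" for n j
    using cs[of n] that by (auto simp: measurable_coloring_def)
  have cm: "c -` {j} \<in> sets lebesgue" if "j \<in> {1..k}" for j
  proof -
    let ?Z = "\<Inter>n. Y n"
    have "c -` {j} = (\<Union>n. cs n -` {j} - Y n) \<union> (if j = 1 then ?Z else {})"
    proof (rule set_eqI)
      fix x
      show "x \<in> c -` {j} \<longleftrightarrow> x \<in> (\<Union>n. cs n -` {j} - Y n) \<union> (if j = 1 then ?Z else {})"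
      proof (cases "x \<in> ?Z")
        case True
        then show ?thesis by (auto simp: c_def)
      next
        case False
        then obtain m where m: "x \<notin> Y m" by blast
        have "(\<exists>n. cs n x = j \<and> x \<notin> Y n) \<longleftrightarrow> c x = j" using m c_eq by metis
        then show ?thesis using False by auto
      qed
    qed
    moreover have "(\<Union>n. cs n -` {j} - Y n) \<in> sets lebesgue"
      using csm[OF that] Y(1) by (intro sets.countable_UN) (auto dest!: fmeasurableD)
    moreover have "?Z \<in> sets lebesgue"
      using Y(1) by (intro sets.countable_INT) (auto dest!: fmeasurableD)
    ultimately show ?thesis by auto
  qed
  have "c x \<in> {1..k}" for x
    using cs k by (auto simp: c_def measurable_coloring_def)
  then have "measurable_coloring k c" using cm by (auto simp: measurable_coloring_def)
  moreover have "\<exists>j\<in>{1..k}. imbalance (Q w) (U w) (c -` {j}) \<noteq> 0" if w: "w \<in> W n" for n w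
  proof -
    obtain j where j: "j \<in> {1..k}" "12 * es (Suc n) \<le> \<bar>imbalance (Q w) (U w) (cs (Suc n) -` {j})\<bar>"
      using good[OF w] by blast
    have "\<bar>imbalance (Q w) (U w) (c -` {j}) - imbalance (Q w) (U w) (cs (Suc n) -` {j})\<bar>
        \<le> 3 * measure lebesgue (Y (Suc n))"
      using QU[OF w] cm[OF j(1)] csm[OF j(1)] Y(1) c_eq
      by (intro imbalance_class_diff_le) auto
    then have "imbalance (Q w) (U w) (c -` {j}) \<noteq> 0"
      using j(2) Y(2)[of "Suc n"] es[of "Suc n"] by auto
    then show ?thesis using j(1) by blast
  qed
  ultimately show ?thesis by blast
qed

section \<open>Unions of cuboids with bounded complexity\<close>

text \<open>
  The indices \<open>(\<alpha> i, \<beta> i)\<close> select the two end points of a cuboid in direction \<open>i\<close> among the values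
  \<open>p i l\<close>, which need not be sorted or distinct.
\<close>
definition pattern :: "('n \<Rightarrow> nat \<Rightarrow> real) \<Rightarrow> (('n \<Rightarrow> nat) \<times> ('n \<Rightarrow> nat)) set \<Rightarrow> (real^'n) set" where
  "pattern p S = (\<Union>(\<alpha>, \<beta>)\<in>S. cbox (\<chi> i. p i (\<alpha> i)) (\<chi> i. p i (\<beta> i)))"

definition index_funs :: "nat \<Rightarrow> ('n \<Rightarrow> nat) set" where
  "index_funs s = {\<alpha>. \<forall>i. \<alpha> i < s}"

text \<open>Open boxes make distinct cells disjoint outright, and keep their points strictly between
  the end points of an enclosing cuboid.\<close>

definition grid_cell :: "nat \<Rightarrow> ('n \<Rightarrow> int) \<Rightarrow> (real^'n) set" where
  "grid_cell N z = box (\<chi> i. of_int (z i) / real N) (\<chi> i. (of_int (z i) + 1) / real N)"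

definition grid_indices :: "int \<Rightarrow> ('n \<Rightarrow> int) set" where
  "grid_indices M = {z. \<forall>i. z i \<in> {-M..M}}"

text \<open>Convention: \<open>p i 0\<close> and \<open>p i 1\<close> are the end points of the cube in direction \<open>i\<close>.\<close>
definition cube_pair :: "(('n \<Rightarrow> nat) \<times> ('n \<Rightarrow> nat)) set" where
  "cube_pair = {(\<lambda>_. 0, \<lambda>_. 1)}"

text \<open>What is kept of a splitting: coordinates bounded by \<open>b\<close>, and a grid cell
  inside the cube that the selected union does not cut. As \<open>p\<close> is an array of reals and
  \<open>S\<close> a set of index pairs, there are \<open>CARD('n) * s\<close> real parameters and
  finitely many choices of \<open>S\<close>.\<close>

definition uncut_patterns ::
  "nat \<Rightarrow> nat \<Rightarrow> nat \<Rightarrow> int \<Rightarrow> (('n::finite \<Rightarrow> nat \<Rightarrow> real) \<times> (('n \<Rightarrow> nat) \<times> ('n \<Rightarrow> nat)) set) set" where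
  "uncut_patterns s b N M = {(p, S). (\<forall>i. \<forall>l<s. \<bar>p i l\<bar> \<le> real b) \<and> S \<subseteq> index_funs s \<times> index_funs s \<and>
     (\<exists>z\<in>grid_indices M. grid_cell N z \<subseteq> pattern p cube_pair \<and>
        (grid_cell N z \<subseteq> pattern p S \<or> grid_cell N z \<inter> pattern p S = {}))}"

section \<open>Finiteness and measurability of patterns and grid cells\<close>

lemma finite_index_funs: "finite (index_funs s :: ('n::finite \<Rightarrow> nat) set)"
proof -
  have "index_funs s = (UNIV \<rightarrow>\<^sub>E {..<s} :: ('n \<Rightarrow> nat) set)" by (auto simp: index_funs_def PiE_iff)
  then show ?thesis by (simp add: finite_PiE)
qed

lemma finite_grid_indices: "finite (grid_indices M :: ('n::finite \<Rightarrow> int) set)"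
proof -
  have "grid_indices M = (UNIV \<rightarrow>\<^sub>E {-M..M} :: ('n \<Rightarrow> int) set)"
    by (auto simp: grid_indices_def PiE_iff)
  then show ?thesis by (simp add: finite_PiE)
qed

lemma lmeasurable_pattern:
  fixes p :: "'n::finite \<Rightarrow> nat \<Rightarrow> real"
  assumes "S \<subseteq> index_funs s \<times> index_funs s"
  shows "pattern p S \<in> lmeasurable"
proof -
  have "finite S" using assms finite_index_funs finite_subset by blast
  then show ?thesis unfolding pattern_def by (intro fmeasurable.finite_UN) auto
qed

lemma cube_pair_subset: "s \<ge> 2 \<Longrightarrow> cube_pair \<subseteq> index_funs s \<times> index_funs s"
  by (auto simp: cube_pair_def index_funs_def)

lemma grid_cell_disjoint:
  fixes z z' :: "'n::finite \<Rightarrow> int"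
  assumes "N \<ge> 1" "z \<noteq> z'"
  shows "grid_cell N z \<inter> grid_cell N z' = {}"
proof (rule ccontr)
  assume "\<not> ?thesis"
  then obtain x where x: "x \<in> grid_cell N z" "x \<in> grid_cell N z'" by blast
  have "z i = z' i" for i
  proof -
    have "of_int (z i) < x$i * N" "x$i * N < of_int (z i) + 1"
      "of_int (z' i) < x$i * N" "x$i * N < of_int (z' i) + 1"
      using x assms(1) by (auto simp: grid_cell_def mem_box_cart field_simps)
    then show ?thesis by linarith
  qed
  then show False using assms(2) by auto
qed

lemma grid_cell_measure_pos:
  fixes z :: "'n::finite \<Rightarrow> int"
  assumes "N \<ge> 1"
  shows "grid_cell N z \<in> lmeasurable" "bounded (grid_cell N z)" "measure lebesgue (grid_cell N z) > 0"
proof -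
  show L: "grid_cell N z \<in> lmeasurable" "bounded (grid_cell N z)" by (auto simp: grid_cell_def)
  have "(\<chi> i. (of_int (z i) + 1/2) / real N) \<in> grid_cell N z"
    using assms by (auto simp: grid_cell_def mem_box_cart divide_strict_right_mono)
  then have "\<not> negligible (grid_cell N z)"
    using open_not_negligible[of "grid_cell N z"] by (auto simp: grid_cell_def)
  then show "measure lebesgue (grid_cell N z) > 0"
    using L(1) by (simp add: negligible_iff_measure zero_less_measure_iff)
qed

text \<open>A point lost in passing from \<open>p\<close> to \<open>p'\<close> obeys the bounds of
  the old box but violates one of the new box, so one of its coordinates lies within
  \<open>\<eta>\<close> of an old end point. The box of radius \<open>b\<close> gives the slabs
  finite measure.\<close>

lemma pattern_symdiff:
  fixes p p' :: "'n::finite \<Rightarrow> nat \<Rightarrow> real"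
  assumes S: "S \<subseteq> index_funs s \<times> index_funs s"
    and p: "\<And>i l. l < s \<Longrightarrow> \<bar>p i l\<bar> \<le> b" "\<And>i l. l < s \<Longrightarrow> \<bar>p' i l\<bar> \<le> b"
    and near: "\<And>i l. l < s \<Longrightarrow> \<bar>p i l - p' i l\<bar> \<le> \<eta>"
  shows "pattern p S - pattern p' S \<subseteq>
     (\<Union>(i, l)\<in>UNIV \<times> {..<s}. cbox (\<chi> i. -b) (\<chi> i. b) \<inter> {x. p i l - \<eta> \<le> x$i \<and> x$i \<le> p i l + \<eta>})"
proof
  fix x assume x: "x \<in> pattern p S - pattern p' S"
  then obtain \<alpha> \<beta> where ab: "(\<alpha>, \<beta>) \<in> S" "\<And>i. p i (\<alpha> i) \<le> x$i \<and> x$i \<le> p i (\<beta> i)"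
    by (auto simp: pattern_def mem_box_cart)
  have lt: "\<alpha> i < s" "\<beta> i < s" for i using ab(1) S by (auto simp: index_funs_def)
  have "x \<notin> cbox (\<chi> i. p' i (\<alpha> i)) (\<chi> i. p' i (\<beta> i))" using x ab(1) by (auto simp: pattern_def)
  then obtain i where i: "x$i < p' i (\<alpha> i) \<or> x$i > p' i (\<beta> i)"
    by (auto simp: mem_box_cart not_le)
  have box: "x \<in> cbox (\<chi> i. -b) (\<chi> i. b)"
    unfolding mem_box_cart
  proof
    fix i
    show "(\<chi> i. -b) $ i \<le> x $ i \<and> x $ i \<le> (\<chi> i. b) $ i"
      using ab(2)[of i] p(1)[OF lt(1), of i i] p(1)[OF lt(2), of i i] by auto
  qed
  show "x \<in> (\<Union>(i, l)\<in>UNIV \<times> {..<s}. cbox (\<chi> i. -b) (\<chi> i. b) \<inter> {x. p i l - \<eta> \<le> x$i \<and> x$i \<le> p i l + \<eta>})"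
    using i
  proof
    assume "x$i < p' i (\<alpha> i)"
    then have "p i (\<alpha> i) - \<eta> \<le> x$i \<and> x$i \<le> p i (\<alpha> i) + \<eta>"
      using ab(2)[of i] near[OF lt(1), of i i] by (auto simp: abs_le_iff)
    then show ?thesis using box lt(1) by (intro UN_I[of "(i, \<alpha> i)"]) auto
  next
    assume "x$i > p' i (\<beta> i)"
    then have "p i (\<beta> i) - \<eta> \<le> x$i \<and> x$i \<le> p i (\<beta> i) + \<eta>"
      using ab(2)[of i] near[OF lt(2), of i i] by (auto simp: abs_le_iff)
    then show ?thesis using box lt(2) by (intro UN_I[of "(i, \<beta> i)"]) auto
  qed
qed

text \<open>The constant 12 is 3 from the imbalance, times 2 for the slabs around the end points of
  both \<open>p\<close> and \<open>p'\<close>, times 2 because a slab has width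
  \<open>2 * \<eta>\<close>.\<close>

lemma imbalance_pattern_close:
  fixes p p' :: "'n::finite \<Rightarrow> nat \<Rightarrow> real"
  assumes S: "S \<subseteq> index_funs s \<times> index_funs s" and s: "s \<ge> 2" and b: "b \<ge> 0" and \<eta>: "\<eta> \<ge> 0"
    and p: "\<And>i l. l < s \<Longrightarrow> \<bar>p i l\<bar> \<le> b" "\<And>i l. l < s \<Longrightarrow> \<bar>p' i l\<bar> \<le> b"
    and near: "\<And>i l. l < s \<Longrightarrow> \<bar>p i l - p' i l\<bar> \<le> \<eta>"
    and A: "A \<in> sets lebesgue"
  shows "\<bar>imbalance (pattern p cube_pair) (pattern p S) A - imbalance (pattern p' cube_pair) (pattern p' S) A\<bar>
      \<le> 12 * (real (CARD('n) * s) * (2 * b) ^ (CARD('n) - 1)) * \<eta>"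
proof -
  define slab where "slab p = (\<lambda>(i, l). cbox (\<chi> i. -b) (\<chi> i. b) \<inter> {x::real^'n. p i l - \<eta> \<le> x$i \<and> x$i \<le> p i l + \<eta>})"
    for p :: "'n \<Rightarrow> nat \<Rightarrow> real"
  define C where "C p = (\<Union>il\<in>UNIV \<times> {..<s}. slab p il)" for p
  have slabL: "slab p il \<in> lmeasurable" for p il
  proof -
    obtain i l where il: "il = (i, l)" by (cases il)
    have "{x::real^'n. p i l - \<eta> \<le> x$i \<and> x$i \<le> p i l + \<eta>} = {x. x$i \<ge> p i l - \<eta>} \<inter> {x. x$i \<le> p i l + \<eta>}"
      by auto
    then show ?thesis unfolding slab_def il
      by (auto intro!: lmeasurable_compact compact_Int_closed closed_Int
          simp: closed_halfspace_component_le_cart closed_halfspace_component_ge_cart)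
  qed
  have CL: "C p \<in> lmeasurable" for p unfolding C_def using slabL by (intro fmeasurable.finite_UN) auto
  have Cm: "measure lebesgue (C p) \<le> real (CARD('n) * s) * (2 * b) ^ (CARD('n) - 1) * (2 * \<eta>)" for p
  proof -
    have "measure lebesgue (C p) \<le> (\<Sum>il\<in>UNIV \<times> {..<s}. measure lebesgue (slab p il))"
      unfolding C_def using slabL by (intro measure_UNION_le) (auto dest: fmeasurableD)
    also have "\<dots> \<le> (\<Sum>il\<in>(UNIV :: 'n set) \<times> {..<s}. (2 * b) ^ (CARD('n) - 1) * (2 * \<eta>))"
    proof (rule sum_mono)
      fix il :: "'n \<times> nat"
      obtain i l where il: "il = (i, l)" by (cases il)
      show "measure lebesgue (slab p il) \<le> (2 * b) ^ (CARD('n) - 1) * (2 * \<eta>)"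
        using slab_measure_le[OF b, of "p i l - \<eta>" "p i l + \<eta>" i] \<eta> by (simp add: slab_def il)
    qed
    also have "\<dots> = real (CARD('n) * s) * (2 * b) ^ (CARD('n) - 1) * (2 * \<eta>)"
      by (simp add: card_cartesian_product)
    finally show ?thesis .
  qed
  have sub: "(pattern p V - pattern p' V) \<union> (pattern p' V - pattern p V) \<subseteq> C p \<union> C p'"
    if "V \<subseteq> index_funs s \<times> index_funs s" for V
  proof -
    have near': "\<bar>p' i l - p i l\<bar> \<le> \<eta>" if "l < s" for i l
      using near[OF that] by (simp add: abs_minus_commute)
    have "pattern p V - pattern p' V \<subseteq> C p"
      unfolding C_def slab_def by (rule pattern_symdiff[OF that p near])
    moreover have "pattern p' V - pattern p V \<subseteq> C p'"
      unfolding C_def slab_def by (rule pattern_symdiff[OF that p(2,1) near'])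
    ultimately show ?thesis by blast
  qed
  have "\<bar>imbalance (pattern p cube_pair) (pattern p S) A - imbalance (pattern p' cube_pair) (pattern p' S) A\<bar>
     \<le> 3 * measure lebesgue (C p \<union> C p')"
    by (rule imbalance_sets_diff_le[OF lmeasurable_pattern[OF cube_pair_subset[OF s]] lmeasurable_pattern[OF S]
          lmeasurable_pattern[OF cube_pair_subset[OF s]] lmeasurable_pattern[OF S] A
          fmeasurable.Un[OF CL CL] sub[OF cube_pair_subset[OF s]] sub[OF S]])
  also have "measure lebesgue (C p \<union> C p') \<le> measure lebesgue (C p) + measure lebesgue (C p')"
    using CL by (intro measure_Un_le) (auto dest: fmeasurableD)
  finally show ?thesis using Cm[of p] Cm[of p'] by (simp add: algebra_simps)
qed

text \<open>The dimension count for splittings: \<open>D\<close> is the number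
  \<open>CARD('n) * s\<close> of real parameters, and rounding them to resolution
  \<open>1 / q\<close> gives at most a constant times \<open>q ^ D\<close> classes.\<close>

lemma pattern_recoloring:
  fixes c :: "real^'n::finite \<Rightarrow> nat"
  assumes col: "measurable_coloring k c" and e: "e > 0" and s: "s \<ge> 2" and b: "b \<ge> 1" and N: "N \<ge> 1"
    and k: "CARD('n) * s + 2 \<le> k"
  shows "\<exists>c' X \<delta>. measurable_coloring k c' \<and> X \<in> lmeasurable \<and> measure lebesgue X \<le> e \<and>
           (\<forall>x. x \<notin> X \<longrightarrow> c' x = c x) \<and> \<delta> > 0 \<and>
           (\<forall>w\<in>uncut_patterns s b N M. \<exists>j\<in>{1..k}.
              \<delta> \<le> \<bar>imbalance (pattern (fst w) cube_pair) (pattern (fst w) (snd w)) (c' -` {j})\<bar>)"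
proof -
  define K where "K = (UNIV :: 'n set) \<times> {..<s}"
  have cK: "card K = CARD('n) * s" "finite K" by (auto simp: K_def card_cartesian_product)
  \<comment> \<open>\<open>q * p\<close> is floored entry by entry, while \<open>S\<close> is kept
    exactly, since it ranges over a finite set. Equal codes then mean corresponding entries at
    distance at most \<open>1 / q\<close>.\<close>
  define R where "R q w = (restrict (\<lambda>(i, l). \<lfloor>real q * fst w i l\<rfloor>) K, snd w)"
    for q :: nat and w :: "('n \<Rightarrow> nat \<Rightarrow> real) \<times> (('n \<Rightarrow> nat) \<times> ('n \<Rightarrow> nat)) set"
  let ?W = "uncut_patterns s b N M :: (('n \<Rightarrow> nat \<Rightarrow> real) \<times> (('n \<Rightarrow> nat) \<times> ('n \<Rightarrow> nat)) set) set"
  let ?I = "index_funs s \<times> index_funs s :: (('n \<Rightarrow> nat) \<times> ('n \<Rightarrow> nat)) set"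
  have W1: "\<bar>fst w i l\<bar> \<le> real b" if "w \<in> ?W" "l < s" for w i l
    using that by (auto simp: uncut_patterns_def)
  have W2: "snd w \<subseteq> ?I" if "w \<in> ?W" for w
    using that by (auto simp: uncut_patterns_def)
  have "finite ?I" using finite_index_funs by blast
  show ?thesis
  proof (rule generic_recoloring[OF col, where Z = "grid_indices M" and G = "grid_cell N" and W = ?W
        and Q = "\<lambda>w. pattern (fst w) cube_pair" and U = "\<lambda>w. pattern (fst w) (snd w)" and R = R
        and C = "(2 * b + 1) ^ card K * 2 ^ card ?I" and D = "card K"
        and L = "12 * (real (CARD('n) * s) * (2 * real b) ^ (CARD('n) - 1))"])
    show "finite (grid_indices M :: ('n \<Rightarrow> int) set)" by (rule finite_grid_indices)
    show "disjoint_family_on (grid_cell N) (grid_indices M)"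
      using grid_cell_disjoint[OF N] by (auto simp: disjoint_family_on_def)
    show "grid_cell N z \<in> lmeasurable \<and> bounded (grid_cell N z) \<and> 0 < measure lebesgue (grid_cell N z)" for z :: "'n \<Rightarrow> int"
      using grid_cell_measure_pos[OF N] by blast
    show "pattern (fst w) cube_pair \<in> lmeasurable \<and> pattern (fst w) (snd w) \<in> lmeasurable" if "w \<in> ?W" for w
      using lmeasurable_pattern[OF cube_pair_subset[OF s]] lmeasurable_pattern[OF W2[OF that]] by blast
    show "\<exists>z\<in>grid_indices M. grid_cell N z \<subseteq> pattern (fst w) cube_pair \<and>
        (grid_cell N z \<subseteq> pattern (fst w) (snd w) \<or> grid_cell N z \<inter> pattern (fst w) (snd w) = {})"
      if "w \<in> ?W" for w using that by (simp add: uncut_patterns_def case_prod_unfold)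
    show "finite (R q ` ?W) \<and> card (R q ` ?W) \<le> (2 * b + 1) ^ card K * 2 ^ card ?I * q ^ card K"
      if q: "1 \<le> q" for q
    proof -
      let ?T = "(K \<rightarrow>\<^sub>E {- int (b * q)..int (b * q)}) \<times> Pow ?I"
      have sub: "R q ` ?W \<subseteq> ?T"
      proof
        fix y assume "y \<in> R q ` ?W"
        then obtain w where w: "w \<in> ?W" "y = R q w" by blast
        have "\<lfloor>real q * fst w i l\<rfloor> \<in> {- int (b * q)..int (b * q)}" if "l < s" for i l
        proof -
          have "\<bar>real q * fst w i l\<bar> \<le> real (b * q)"
            using mult_left_mono[OF W1[OF w(1) that, of i], of "real q"] by (simp add: abs_mult mult.commute)
          then have "real_of_int (- int (b * q)) \<le> real q * fst w i l" "real q * fst w i l \<le> real_of_int (int (b * q))"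
            by (auto simp: abs_le_iff)
          then show ?thesis by (simp add: le_floor_iff floor_le_iff)
        qed
        then show "y \<in> ?T" using W2[OF w(1)] by (auto simp: w(2) R_def K_def)
      qed
      have fin: "finite ?T" using cK(2) \<open>finite ?I\<close> by (simp add: finite_PiE)
      have "card (R q ` ?W) \<le> card ?T" by (rule card_mono[OF fin sub])
      also have "\<dots> = (2 * (b * q) + 1) ^ card K * 2 ^ card ?I"
      proof -
        have "card {- int (b * q)..int (b * q)} = 2 * (b * q) + 1"
          unfolding card_atLeastAtMost_int by linarith
        then show ?thesis
          using cK(2) \<open>finite ?I\<close> by (simp only: card_cartesian_product card_Pow card_PiE prod_constant)
      qed
      also have "\<dots> \<le> ((2 * b + 1) * q) ^ card K * 2 ^ card ?I"
        using q by (intro mult_right_mono power_mono) (auto simp: algebra_simps)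
      also have "\<dots> = (2 * b + 1) ^ card K * 2 ^ card ?I * q ^ card K"
        by (simp only: power_mult_distrib mult_ac)
      finally show ?thesis using finite_subset[OF sub fin] by blast
    qed
    show "\<bar>imbalance (pattern (fst w) cube_pair) (pattern (fst w) (snd w)) A -
           imbalance (pattern (fst w') cube_pair) (pattern (fst w') (snd w')) A\<bar>
          \<le> 12 * (real (CARD('n) * s) * (2 * real b) ^ (CARD('n) - 1)) / real q"
      if q: "1 \<le> q" and w: "w \<in> ?W" "w' \<in> ?W" and eq: "R q w = R q w'" and A: "A \<in> sets lebesgue"
      for q w w' A
    proof -
      have S: "snd w = snd w'" using eq by (simp add: R_def)
      have near: "\<bar>fst w i l - fst w' i l\<bar> \<le> 1 / real q" if "l < s" for i l
      proof -
        have "\<lfloor>real q * fst w i l\<rfloor> = \<lfloor>real q * fst w' i l\<rfloor>"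
          using arg_cong[OF eq, of "\<lambda>y. fst y (i, l)"] that by (simp add: R_def K_def)
        then have "\<bar>real q * fst w i l - real q * fst w' i l\<bar> \<le> 1" by linarith
        then have "real q * \<bar>fst w i l - fst w' i l\<bar> \<le> 1"
          by (simp add: abs_mult flip: right_diff_distrib)
        then show ?thesis using q by (simp add: field_simps)
      qed
      show ?thesis
        using imbalance_pattern_close[OF W2[OF w(1)] s _ _ W1[OF w(1)] W1[OF w(2)] near A]
        by (simp add: S)
    qed
    show "0 < 12 * (real (CARD('n) * s) * (2 * real b) ^ (CARD('n) - 1))" using s b by simp
    show "card K + 2 \<le> k" using k cK by simp
  qed (rule e)
qed

section \<open>Fair splittings\<close>

text \<open>An end point of a cell other than \<open>lo\<close> and \<open>hi\<close> is a cut. If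
  the two cells had different end points, such a cut would lie strictly inside one of them.\<close>

lemma split_cells_overlap_eq:
  assumes H: "H \<subseteq> {lo<..<hi}" and lh: "lo < hi"
    and uv: "{u..v} \<in> split_cells lo hi H" "u < v" and I: "I \<in> split_cells lo hi H"
    and x: "x \<in> I" "u < x" "x < v"
  shows "I = {u..v}"
proof -
  obtain u1 v1 where 1: "{u..v} = {u1..v1}" "u1 \<in> insert lo (insert hi H)" "v1 \<in> insert lo (insert hi H)"
    "u1 < v1" "\<forall>s\<in>H. \<not> (u1 < s \<and> s < v1)"
    using uv(1) unfolding split_cells_def by blast
  have e: "u1 = u" "v1 = v" using 1(1) uv(2) 1(4) by (auto simp: Icc_eq_Icc)
  note uv1 = 1(2-5)[unfolded e]
  obtain u' v' where 2: "I = {u'..v'}" "u' \<in> insert lo (insert hi H)" "v' \<in> insert lo (insert hi H)"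
    "u' < v'" "\<forall>s\<in>H. \<not> (u' < s \<and> s < v')"
    using I unfolding split_cells_def by blast
  have bounds: "lo \<le> y \<and> y \<le> hi" if "y \<in> insert lo (insert hi H)" for y
    using that H lh by (auto simp: less_imp_le)
  have mem: "y \<in> H" if "y \<in> insert lo (insert hi H)" "lo < y" "y < hi" for y using that by auto
  have x': "u' \<le> x" "x \<le> v'" using x(1) 2(1) by auto
  note bds = bounds[OF uv1(1)] bounds[OF uv1(2)] bounds[OF 2(2)] bounds[OF 2(3)]
  have "u' = u"
  proof (rule ccontr)
    assume "u' \<noteq> u"
    then consider "u < u'" | "u' < u" by linarith
    then show False
    proof cases
      case 1
      have "u' \<in> H" using 1 bds 2(4) by (intro mem[OF 2(2)]) auto
      then show False using uv1(4) 1 x' x(3) by auto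
    next
      case 2
      have "u \<in> H" using 2 bds uv(2) by (intro mem[OF uv1(1)]) auto
      then show False using \<open>\<forall>s\<in>H. \<not> (u' < s \<and> s < v')\<close> 2 x' x(2) by auto
    qed
  qed
  moreover have "v' = v"
  proof (rule ccontr)
    assume "v' \<noteq> v"
    then consider "v' < v" | "v < v'" by linarith
    then show False
    proof cases
      case 1
      have "v' \<in> H" using 1 bds 2(4) by (intro mem[OF 2(3)]) auto
      then show False using uv1(4) 1 x' x(2) by auto
    next
      case 2
      have "v \<in> H" using 2 bds uv(2) by (intro mem[OF uv1(2)]) auto
      then show False using \<open>\<forall>s\<in>H. \<not> (u' < s \<and> s < v')\<close> 2 x' x(3) by auto
    qed
  qed
  ultimately show ?thesis using 2(1) by simp
qed

text \<open>Pigeonhole: the \<open>t + 1\<close> open windows of length \<open>r / (t + 1)\<close>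
  are disjoint, so at most \<open>t\<close> cuts leave one of them free.\<close>

lemma split_cells_long_cell:
  assumes fin: "finite H" and H: "H \<subseteq> {lo<..<lo + r}" and r: "r > 0" and card: "card H \<le> t"
  shows "\<exists>u v. {u..v} \<in> split_cells lo (lo + r) H \<and> lo \<le> u \<and> v \<le> lo + r \<and> v - u \<ge> r / (real t + 1)"
proof -
  define g where "g = r / (real t + 1)"
  have g: "g > 0" "(real t + 1) * g = r" using r by (auto simp: g_def)
  have "\<exists>m\<le>t. \<forall>s\<in>H. \<not> (lo + real m * g < s \<and> s < lo + (real m + 1) * g)"
  proof (rule ccontr)
    assume "\<not> ?thesis"
    then have "\<forall>m\<in>{..t}. \<exists>s\<in>H. lo + real m * g < s \<and> s < lo + (real m + 1) * g" by auto
    then obtain f where f: "\<And>m. m \<le> t \<Longrightarrow> f m \<in> H \<and> lo + real m * g < f m \<and> f m < lo + (real m + 1) * g"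
      by (metis atMost_iff)
    have lt: "f m < f m'" if "m < m'" "m' \<le> t" for m m'
    proof -
      have "real m + 1 \<le> real m'" using that by simp
      then have "(real m + 1) * g \<le> real m' * g" using g by (intro mult_right_mono) auto
      then show ?thesis using f[of m] f[of m'] that by auto
    qed
    have "inj_on f {..t}"
      by (rule linorder_inj_onI) (use lt in force)+
    then have "card {..t} \<le> card H" using f fin by (intro card_inj_on_le[of f]) auto
    then show False using card by simp
  qed
  then obtain m where m: "m \<le> t" "\<And>s. s \<in> H \<Longrightarrow> \<not> (lo + real m * g < s \<and> s < lo + (real m + 1) * g)"
    by blast
  let ?P = "insert lo (insert (lo + r) H)"
  \<comment> \<open>The cell is the gap around the free window: it runs from the last end point or
    cut before the window to the first one after it.\<close>
  let ?A = "{p \<in> ?P. p \<le> lo + real m * g}" and ?B = "{p \<in> ?P. p \<ge> lo + (real m + 1) * g}"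
  have "(real m + 1) * g \<le> r"
    unfolding g(2)[symmetric] using m(1) g(1) by (intro mult_right_mono) auto
  then have A: "finite ?A" "?A \<noteq> {}" and B: "finite ?B" "?B \<noteq> {}" using fin g(1) by auto
  define u v where "u = Max ?A" and "v = Min ?B"
  have u: "u \<in> ?A" and v: "v \<in> ?B" unfolding u_def v_def using Max_in[OF A] Min_in[OF B] by auto
  have gap: "\<not> (u < s \<and> s < v)" if s: "s \<in> H" for s
  proof
    assume us: "u < s \<and> s < v"
    have "s \<notin> ?A" using Max_ge[OF A(1), of s] us by (auto simp: u_def)
    moreover have "s \<notin> ?B" using Min_le[OF B(1), of s] us by (auto simp: v_def)
    ultimately show False using m(2)[OF s] s by auto
  qed
  have len: "v - u \<ge> g" using u v by (auto simp: algebra_simps)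
  have "{u..v} \<in> split_cells lo (lo + r) H"
    unfolding split_cells_def using u v gap len g(1) by (auto intro!: exI[of _ u] exI[of _ v])
  moreover have "lo \<le> u" "v \<le> lo + r" using u v H r by (auto simp: less_imp_le)
  ultimately show ?thesis using len by (auto simp: g_def)
qed

lemma cuboid_eq_cbox: "{x::real^'n::finite. \<forall>i. x$i \<in> {u i..v i}} = cbox (\<chi> i. u i) (\<chi> i. v i)"
  by (auto simp: mem_box_cart)

text \<open>Long cells in all directions form a cuboid \<open>f\<close> that contains a grid cell,
  and no other cuboid meets this grid cell. It therefore lies inside \<open>\<Union>F\<close> or is
  disjoint from it, according to whether \<open>f \<in> F\<close>.\<close>

lemma splitting_is_uncut_pattern:
  fixes a :: "real^'n::finite"
  assumes H: "\<And>i. finite (H i) \<and> H i \<subseteq> {a$i<..<a$i + r} \<and> card (H i) \<le> t"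
    and r: "r > 0" and F: "F \<subseteq> split_cuboids a r H"
    and b: "\<And>i. \<bar>a$i\<bar> \<le> real b" "\<And>i. \<bar>a$i + r\<bar> \<le> real b"
    and N: "N \<ge> 1" "r / (real t + 1) \<ge> 2 / real N"
  shows "\<exists>p S. (p, S) \<in> uncut_patterns (t + 2) b N (int (b * N)) \<and>
           pattern p cube_pair = cube_of a r \<and> pattern p S = \<Union>F"
proof -
  have "\<exists>xs. set xs = H i \<and> length xs \<le> t" for i
    using H[of i] by (metis distinct_card finite_distinct_list)
  then obtain xs where xs: "\<And>i. set (xs i) = H i" "\<And>i. length (xs i) \<le> t" by metis
  \<comment> \<open>Cuts start at index 2, after the two ends of the cube. Missing cuts are padded
    with \<open>a$i\<close>, so that \<open>t + 2\<close> entries are always available.\<close>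
  define p where "p i l = (if l = 0 then a$i else if l = 1 then a$i + r
      else if l - 2 < length (xs i) then xs i ! (l - 2) else a$i)" for i l
  let ?P = "\<lambda>i. insert (a$i) (insert (a$i + r) (H i))"
  have p01: "p i 0 = a$i" "p i 1 = a$i + r" for i by (auto simp: p_def)
  have pP: "p i l \<in> ?P i" for i l using xs(1)[of i] nth_mem[of "l - 2" "xs i"] by (auto simp: p_def)
  have surj: "\<exists>l<t + 2. p i l = y" if y: "y \<in> ?P i" for i y
  proof -
    consider "y = a$i" | "y = a$i + r" | "y \<in> set (xs i)" using y xs by auto
    then show ?thesis
    proof cases
      case 1 then show ?thesis using p01 by (intro exI[of _ 0]) auto
    next
      case 2 then show ?thesis using p01 by (intro exI[of _ 1]) auto
    next
      case 3
      then obtain l where "l < length (xs i)" "xs i ! l = y" by (auto simp: in_set_conv_nth)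
      then show ?thesis using xs(2)[of i] by (intro exI[of _ "l + 2"]) (auto simp: p_def)
    qed
  qed
  have pb: "\<bar>p i l\<bar> \<le> real b" for i l
  proof -
    have "a$i \<le> p i l" "p i l \<le> a$i + r" using pP[of i l] H[of i] r by (auto simp: less_imp_le)
    then show ?thesis using b(1)[of i] b(2)[of i] by (auto simp: abs_le_iff)
  qed
  define S where "S = {(\<alpha>, \<beta>). \<alpha> \<in> index_funs (t + 2) \<and> \<beta> \<in> index_funs (t + 2) \<and>
      cbox (\<chi> i. p i (\<alpha> i)) (\<chi> i. p i (\<beta> i)) \<in> F}"
  have SF: "pattern p S = \<Union>F"
  proof
    show "pattern p S \<subseteq> \<Union>F" by (auto simp: pattern_def S_def)
    show "\<Union>F \<subseteq> pattern p S"
    proof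
      fix x assume "x \<in> \<Union>F"
      then obtain f where f: "f \<in> F" "x \<in> f" by blast
      then have "f \<in> split_cuboids a r H" using F by blast
      then obtain I where I: "f = {x. \<forall>i. x$i \<in> I i}" "\<And>i. I i \<in> split_cells (a$i) (a$i + r) (H i)"
        unfolding split_cuboids_def by blast
      have "\<forall>i. \<exists>\<alpha> \<beta>. \<alpha> < t + 2 \<and> \<beta> < t + 2 \<and> I i = {p i \<alpha>..p i \<beta>}"
      proof
        fix i
        obtain u v where uv: "I i = {u..v}" "u \<in> ?P i" "v \<in> ?P i"
          using I(2)[of i] unfolding split_cells_def by blast
        obtain \<alpha> \<beta> where "\<alpha> < t + 2" "p i \<alpha> = u" "\<beta> < t + 2" "p i \<beta> = v"
          using surj[OF uv(2)] surj[OF uv(3)] by blast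
        then show "\<exists>\<alpha> \<beta>. \<alpha> < t + 2 \<and> \<beta> < t + 2 \<and> I i = {p i \<alpha>..p i \<beta>}"
          using uv(1) by blast
      qed
      then obtain \<alpha> \<beta> where ab: "\<And>i. \<alpha> i < t + 2 \<and> \<beta> i < t + 2 \<and> I i = {p i (\<alpha> i)..p i (\<beta> i)}" by metis
      have fc: "f = cbox (\<chi> i. p i (\<alpha> i)) (\<chi> i. p i (\<beta> i))"
        unfolding I(1) cuboid_eq_cbox[symmetric] using ab by simp
      then have "(\<alpha>, \<beta>) \<in> S" using ab f(1) by (auto simp: S_def index_funs_def)
      then show "x \<in> pattern p S" using f(2) fc unfolding pattern_def by blast
    qed
  qed
  have cube: "pattern p cube_pair = cube_of a r"
    by (auto simp: pattern_def cube_pair_def cube_of_def mem_box_cart p_def)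
  have "\<forall>i. \<exists>u v. {u..v} \<in> split_cells (a$i) (a$i + r) (H i) \<and> a$i \<le> u \<and> v \<le> a$i + r \<and> v - u \<ge> r / (real t + 1)"
    using split_cells_long_cell H r by blast
  then obtain u v where uv: "\<And>i. {u i..v i} \<in> split_cells (a$i) (a$i + r) (H i)"
    "\<And>i. a$i \<le> u i" "\<And>i. v i \<le> a$i + r" "\<And>i. v i - u i \<ge> r / (real t + 1)" by metis
  \<comment> \<open>Rounding \<open>u i\<close> up to the grid loses less than \<open>1 / N\<close>
    and the grid cell takes another \<open>1 / N\<close>; hence the length \<open>2 / N\<close>
    demanded of the long cell.\<close>
  define z where "z i = \<lceil>u i * real N\<rceil>" for i
  have N0: "real N > 0" using N by simp
  have zu: "u i \<le> of_int (z i) / real N" "(of_int (z i) + 1) / real N \<le> v i" for i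
  proof -
    have "u i * real N \<le> of_int (z i)" by (simp add: z_def)
    then show "u i \<le> of_int (z i) / real N" using N0 by (simp add: field_simps)
    have "of_int (z i) < u i * real N + 1" unfolding z_def by linarith
    then have "(of_int (z i) + 1) / real N \<le> (u i * real N + 2) / real N"
      using N0 by (intro divide_right_mono) auto
    also have "\<dots> = u i + 2 / real N" using N0 by (simp add: add_divide_distrib)
    finally have "(of_int (z i) + 1) / real N \<le> u i + 2 / real N" .
    then show "(of_int (z i) + 1) / real N \<le> v i" using uv(4)[of i] N(2) by linarith
  qed
  have "z i \<in> {- int (b * N)..int (b * N)}" for i
  proof -
    have "u i < v i" using uv(4)[of i] r by (smt (verit) divide_pos_pos of_nat_0_le_iff)
    then have "\<bar>u i\<bar> \<le> real b" using uv(2)[of i] uv(3)[of i] b(1)[of i] b(2)[of i] by linarith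
    then have "\<bar>u i * real N\<bar> \<le> real b * real N" by (simp add: abs_mult mult_right_mono)
    then have "- real (b * N) \<le> u i * real N" "u i * real N \<le> real (b * N)" by auto
    then have "z i \<le> int (b * N)" "- int (b * N) \<le> z i" unfolding z_def by linarith+
    then show ?thesis by simp
  qed
  then have zM: "z \<in> grid_indices (int (b * N))" by (simp add: grid_indices_def)
  have G: "u i < x$i \<and> x$i < v i" if "x \<in> grid_cell N z" for x i
  proof -
    have "of_int (z i) / real N < x$i" "x$i < (of_int (z i) + 1) / real N"
      using that by (auto simp: grid_cell_def mem_box_cart)
    then show ?thesis using zu[of i] by linarith
  qed
  define f where "f = {x::real^'n. \<forall>i. x$i \<in> {u i..v i}}"
  have fS: "f \<in> split_cuboids a r H"
    unfolding split_cuboids_def f_def using uv(1) by (auto intro!: exI[of _ "\<lambda>i. {u i..v i}"])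
  have Gf: "grid_cell N z \<subseteq> f"
    unfolding f_def using G by (simp add: subset_iff less_imp_le)
  have "grid_cell N z \<subseteq> cube_of a r"
  proof
    fix x assume x: "x \<in> grid_cell N z"
    have "a$i \<le> x$i \<and> x$i \<le> a$i + r" for i using G[OF x, of i] uv(2,3)[of i] by linarith
    then show "x \<in> cube_of a r" by (simp add: cube_of_def)
  qed
  moreover have "grid_cell N z \<subseteq> \<Union>F \<or> grid_cell N z \<inter> \<Union>F = {}"
  proof (cases "f \<in> F")
    case True
    then show ?thesis using Gf by blast
  next
    case False
    have "x \<notin> f'" if x: "x \<in> grid_cell N z" and f': "f' \<in> F" for x f'
    proof
      assume xf: "x \<in> f'"
      obtain I where I: "f' = {x. \<forall>i. x$i \<in> I i}" "\<And>i. I i \<in> split_cells (a$i) (a$i + r) (H i)"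
        using f' F unfolding split_cuboids_def by blast
      have "I i = {u i..v i}" for i
      proof (rule split_cells_overlap_eq[OF _ _ uv(1) _ I(2)])
        show "u i < x$i" "x$i < v i" using G[OF x] by auto
        then show "u i < v i" by linarith
        show "x$i \<in> I i" using xf I(1) by blast
      qed (use H r in auto)
      then have "f' = f" unfolding I(1) f_def by simp
      then show False using False f' by simp
    qed
    then show ?thesis by blast
  qed
  ultimately have "(p, S) \<in> uncut_patterns (t + 2) b N (int (b * N))"
    unfolding uncut_patterns_def using pb zM by (auto simp: cube SF) (auto simp: S_def)
  then show ?thesis using cube SF by blast
qed

theorem theorem3:
  fixes t k :: nat
  assumes "t \<ge> 1"
    and "int k \<ge> (int t + 4) ^ CARD('n::finite) - (int t + 3) ^ CARD('n) + (int t + 2) ^ CARD('n)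
                  - 2 ^ CARD('n) + int CARD('n) * (int t + 2) + 3"
  shows "\<exists>c :: real^'n \<Rightarrow> nat.
           (\<forall>x. c x \<in> {1..k}) \<and> (\<forall>j\<in>{1..k}. c -` {j} \<in> sets lebesgue) \<and>
           (\<forall>a r H. r > 0 \<longrightarrow> (\<forall>i. card (H i) \<le> t) \<longrightarrow> \<not> fair_splitting c k a r H)"
proof -
  \<comment> \<open>Both differences of powers are nonnegative, so the linear term of the bound
    carries the dimension count.\<close>
  have "(int t + 3) ^ CARD('n) \<le> (int t + 4) ^ CARD('n)" "2 ^ CARD('n) \<le> (int t + 2) ^ CARD('n)"
    by (intro power_mono; simp)+
  then have "int CARD('n) * (int t + 2) + 2 \<le> int k" using assms(2) by linarith
  also have "int CARD('n) * (int t + 2) + 2 = int (CARD('n) * (t + 2) + 2)" by (simp add: algebra_simps)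
  finally have k: "CARD('n) * (t + 2) + 2 \<le> k" by linarith
  \<comment> \<open>Chosen so that \<open>2 / N n\<close> is \<open>1 / Suc n\<close> divided by
    \<open>t + 1\<close>: stage \<open>n\<close> then handles cubes of side at least
    \<open>1 / Suc n\<close> whose coordinates are at most \<open>Suc n\<close> in absolute
    value.\<close>
  define N where "N n = 2 * Suc n * (t + 1)" for n
  define W where "W n = (uncut_patterns (t + 2) (Suc n) (N n) (int (Suc n * N n)) ::
      (('n \<Rightarrow> nat \<Rightarrow> real) \<times> (('n \<Rightarrow> nat) \<times> ('n \<Rightarrow> nat)) set) set)" for n
  have N1: "N n \<ge> 1" for n by (simp add: N_def)
  have "\<exists>c. measurable_coloring k c \<and> (\<forall>n. \<forall>w\<in>W n. \<exists>j\<in>{1..k}.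
      imbalance (pattern (fst w) cube_pair) (pattern (fst w) (snd w)) (c -` {j}) \<noteq> 0)"
  proof (rule limit_coloring)
    show "pattern (fst w) cube_pair \<in> lmeasurable \<and> pattern (fst w) (snd w) \<in> lmeasurable"
      if "w \<in> W n" for n w
    proof -
      have sub: "snd w \<subseteq> index_funs (t + 2) \<times> index_funs (t + 2)"
        using that by (auto simp: W_def uncut_patterns_def)
      show ?thesis
        using lmeasurable_pattern[OF cube_pair_subset[of "t + 2"]] lmeasurable_pattern[OF sub] by simp
    qed
  qed (use k pattern_recoloring[OF _ _ _ _ N1 k] in \<open>auto simp: W_def\<close>)
  then obtain c :: "real^'n \<Rightarrow> nat" where c: "measurable_coloring k c"
    "\<And>n w. w \<in> W n \<Longrightarrow> \<exists>j\<in>{1..k}.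
      imbalance (pattern (fst w) cube_pair) (pattern (fst w) (snd w)) (c -` {j}) \<noteq> 0" by blast
  have "\<not> fair_splitting c k a r H" if r: "r > 0" and H: "\<forall>i. card (H i) \<le> t" for a r H
  proof
    assume fair: "fair_splitting c k a r H"
    then obtain F where F: "F \<subseteq> split_cuboids a r H" "\<And>j. j \<in> {1..k} \<Longrightarrow>
        measure lebesgue (c -` {j} \<inter> \<Union>F) = measure lebesgue (c -` {j} \<inter> cube_of a r) / 2"
      unfolding fair_splitting_def by blast
    have H': "finite (H i) \<and> H i \<subseteq> {a$i<..<a$i + r} \<and> card (H i) \<le> t" for i
      using fair H unfolding fair_splitting_def by blast
    obtain n where n: "1 / r + norm a + r \<le> real n" using real_arch_simple by blast
    have ai: "\<bar>a$i\<bar> \<le> norm a" for i by (rule component_le_norm_cart)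
    have pos: "1 / r > 0" "norm a \<ge> 0" using r by auto
    have b1: "\<bar>a$i\<bar> \<le> real (Suc n)" for i using ai[of i] n r pos by (simp, linarith)
    have b2: "\<bar>a$i + r\<bar> \<le> real (Suc n)" for i using ai[of i] n r pos by (simp, linarith)
    have "1 / r \<le> real (Suc n)" using n pos r by (simp, linarith)
    then have "1 / real (Suc n) \<le> r" using r by (simp add: field_simps)
    moreover have "2 / real (N n) = (1 / real (Suc n)) / (real t + 1)"
    proof -
      have "real (N n) = 2 * (real (Suc n) * (real t + 1))" by (simp add: N_def algebra_simps)
      then show ?thesis by (simp only: divide_divide_eq_left mult_divide_mult_cancel_left_if) simp
    qed
    ultimately have N2: "r / (real t + 1) \<ge> 2 / real (N n)"
      by (simp only:) (intro divide_right_mono; simp)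
    obtain p S where pS: "(p, S) \<in> W n" "pattern p cube_pair = cube_of a r" "pattern p S = \<Union>F"
      using splitting_is_uncut_pattern[OF H' r F(1) b1 b2 N1 N2] unfolding W_def by blast
    \<comment> \<open>The equations for \<open>F\<close> say that every colour has imbalance zero
      for this pair, whereas the colouring provides a colour with nonzero imbalance.\<close>
    then show False using c(2)[OF pS(1)] F(2) by (auto simp: imbalance_def)
  qed
  then show ?thesis using c(1) unfolding measurable_coloring_def by blast
qed

end
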